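(* (Provable in ${\sf RCA}_0$.) Let $T$ be a tree and $T^*=T^+\cup\{\sigma^\frown0\mid\sigma\in T^+\}$ where $T^+=\{\sigma+1\mid\sigma\in T\}$. Then: (1) $T$ is well-founded if and only if $T^*$ is well-founded; (2) $T$ has at most one infinite path if and only if $T^*$ has at most one infinite path; (3) $S$ is a perfect subtree of $T$ if and only if $S^+=\{\sigma+1\mid\sigma\in S\}$ is a perfect subtree of $T^*$; (4) $K$ is the perfect kernel of $T$ if and only if $K^+=\{\sigma+1\mid\sigma\in K\}$ is the perfect kernel of $T^*$.
   Context: A tree is a set of finite sequences of natural numbers closed under initial subsequences; it is well-founded if it has no infinite path. For a finite sequence $\sigma$, $\sigma+1$ is the sequence of the same length with $(\sigma+1)(n)=\sigma(n)+1$. A subtree $S$ of $T$ is perfect if every sequence in $S$ has two incompatible extensions in $S$. The perfect kernel of $T$ is the union of all perfect subtrees of $T$. *)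

theory Defs
  imports Main
begin

text \<open>
  Structures for the language of second-order arithmetic.  The number quantifiers range over the
  whole type \<open>'n\<close>, the set quantifiers over \<open>Sets M\<close> (Henkin semantics), and equality is
  interpreted as true equality.  No standardness of \<open>'n\<close> is assumed.
\<close>

record 'n L2_structure =
  zero :: 'n (\<open>\<zero>\<index>\<close>)
  one :: 'n (\<open>\<one>\<index>\<close>)
  add :: "'n \<Rightarrow> 'n \<Rightarrow> 'n" (infixl \<open>\<oplus>\<index>\<close> 65)
  mult :: "'n \<Rightarrow> 'n \<Rightarrow> 'n" (infixl \<open>\<otimes>\<index>\<close> 70)
  less :: "'n \<Rightarrow> 'n \<Rightarrow> bool" (infix \<open>\<prec>\<index>\<close> 50)
  Sets :: "'n set set"

text \<open>
  Terms and \<open>\<Delta>\<^sup>0\<^sub>0\<close> formulas (bounded number quantifiers only, free set variables allowed).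
  Number variables are de Bruijn indices; set variables are never bound and are just names.
  In \<open>BAll t \<theta>\<close>, for \<open>\<forall>x < t. \<theta>\<close>, the bound \<open>t\<close> lies outside the scope of the quantifier.
\<close>

datatype tm = Var nat | Zero | One | Add tm tm | Mult tm tm

datatype bfm =
    Eq tm tm
  | Less tm tm
  | Mem tm nat
  | Neg bfm
  | Conj bfm bfm
  | BAll tm bfm

locale L2 =
  fixes M :: "'n L2_structure" (structure)
begin

primrec tval :: "(nat \<Rightarrow> 'n) \<Rightarrow> tm \<Rightarrow> 'n" where
  "tval e (Var i) = e i"
| "tval e Zero = \<zero>"
| "tval e One = \<one>"
| "tval e (Add s t) = tval e s \<oplus> tval e t"
| "tval e (Mult s t) = tval e s \<otimes> tval e t"

primrec bsat :: "(nat \<Rightarrow> 'n set) \<Rightarrow> (nat \<Rightarrow> 'n) \<Rightarrow> bfm \<Rightarrow> bool" where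
  "bsat E e (Eq s t) \<longleftrightarrow> tval e s = tval e t"
| "bsat E e (Less s t) \<longleftrightarrow> tval e s \<prec> tval e t"
| "bsat E e (Mem t X) \<longleftrightarrow> tval e t \<in> E X"
| "bsat E e (Neg \<theta>) \<longleftrightarrow> \<not> bsat E e \<theta>"
| "bsat E e (Conj \<theta> \<theta>') \<longleftrightarrow> bsat E e \<theta> \<and> bsat E e \<theta>'"
| "bsat E e (BAll t \<theta>) \<longleftrightarrow> (\<forall>x. x \<prec> tval e t \<longrightarrow> bsat E (case_nat x e) \<theta>)"

text \<open>
  The formulas \<open>\<exists>k. \<theta>(k, n)\<close> and \<open>\<forall>k. \<theta>(k, n)\<close> in the distinguished variable \<open>n\<close>, for \<open>\<theta>\<close>
  in \<open>\<Delta>\<^sup>0\<^sub>0\<close>; the assignments \<open>e\<close> and \<open>E\<close> supply number and set parameters.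
\<close>

definition sat_\<Sigma>1 :: "bfm \<Rightarrow> (nat \<Rightarrow> 'n set) \<Rightarrow> (nat \<Rightarrow> 'n) \<Rightarrow> 'n \<Rightarrow> bool" where
  "sat_\<Sigma>1 \<theta> E e n \<longleftrightarrow> (\<exists>k. bsat E (case_nat k (case_nat n e)) \<theta>)"

definition sat_\<Pi>1 :: "bfm \<Rightarrow> (nat \<Rightarrow> 'n set) \<Rightarrow> (nat \<Rightarrow> 'n) \<Rightarrow> 'n \<Rightarrow> bool" where
  "sat_\<Pi>1 \<theta> E e n \<longleftrightarrow> (\<forall>k. bsat E (case_nat k (case_nat n e)) \<theta>)"

end

text \<open>Models of \<open>RCA\<^sub>0\<close>, axiomatised as in Simpson, Subsystems of Second Order Arithmetic.\<close>

locale RCA0 = L2 M for M :: "'n L2_structure" (structure) +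
  assumes succ_neq_zero: "n \<oplus> \<one> \<noteq> \<zero>"
    and succ_inject: "m \<oplus> \<one> = n \<oplus> \<one> \<Longrightarrow> m = n"
    and add_zero: "m \<oplus> \<zero> = m"
    and add_succ: "m \<oplus> (n \<oplus> \<one>) = (m \<oplus> n) \<oplus> \<one>"
    and mult_zero: "m \<otimes> \<zero> = \<zero>"
    and mult_succ: "m \<otimes> (n \<oplus> \<one>) = (m \<otimes> n) \<oplus> m"
    and not_less_zero: "\<not> m \<prec> \<zero>"
    and less_succ: "m \<prec> n \<oplus> \<one> \<longleftrightarrow> m \<prec> n \<or> m = n"
    and \<Sigma>1_induction:
      "\<lbrakk>range E \<subseteq> Sets M; sat_\<Sigma>1 \<theta> E e \<zero>;
        \<forall>n. sat_\<Sigma>1 \<theta> E e n \<longrightarrow> sat_\<Sigma>1 \<theta> E e (n \<oplus> \<one>)\<rbrakk> \<Longrightarrow> \<forall>n. sat_\<Sigma>1 \<theta> E e n"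
    and \<Delta>1_comprehension:
      "\<lbrakk>range E \<subseteq> Sets M; \<forall>n. sat_\<Sigma>1 \<theta> E e n \<longleftrightarrow> sat_\<Pi>1 \<theta>' E e n\<rbrakk>
        \<Longrightarrow> \<exists>X\<in>Sets M. \<forall>n. n \<in> X \<longleftrightarrow> sat_\<Sigma>1 \<theta> E e n"

text \<open>
  Finite sequences are numbers, coded as is usual in \<open>RCA\<^sub>0\<close> (Simpson, Section II.2): a finite set
  is coded by the least triple \<open>(k, (m, n))\<close> such that its elements are the \<open>i < k\<close> for which
  \<open>m (i + 1) + 1\<close> divides \<open>n\<close>, and a finite sequence is (the code of) a finite set of pairs that
  is a function on an initial segment of the numbers.  All quantifiers below over \<open>'n\<close> are the
  number quantifiers of the structure, so lengths and entries may be nonstandard.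
\<close>

context L2
begin

definition pair :: "'n \<Rightarrow> 'n \<Rightarrow> 'n" where
  "pair i j = (i \<oplus> j) \<otimes> (i \<oplus> j) \<oplus> i"

definition divides :: "'n \<Rightarrow> 'n \<Rightarrow> bool" where
  "divides m n \<longleftrightarrow> (\<exists>q. n = m \<otimes> q)"

definition triple :: "'n \<Rightarrow> bool" where
  "triple c \<longleftrightarrow> (\<exists>k m n. c = pair k (pair m n))"

definition elem :: "'n \<Rightarrow> 'n \<Rightarrow> bool" where
  "elem i c \<longleftrightarrow>
    (\<exists>k m n. c = pair k (pair m n) \<and> i \<prec> k \<and> divides (m \<otimes> (i \<oplus> \<one>) \<oplus> \<one>) n)"

definition set_code :: "'n \<Rightarrow> bool" where
  "set_code c \<longleftrightarrow>
    triple c \<and> (\<forall>c'. triple c' \<and> c' \<prec> c \<longrightarrow> \<not> (\<forall>i. elem i c' \<longleftrightarrow> elem i c))"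

text \<open>The \<open>i\<close>-th entry of \<open>\<sigma>\<close> exists and is \<open>a\<close>; the length of \<open>\<sigma>\<close> is \<open>l\<close>.\<close>

definition entry :: "'n \<Rightarrow> 'n \<Rightarrow> 'n \<Rightarrow> bool" where
  "entry \<sigma> i a \<longleftrightarrow> elem (pair i a) \<sigma>"

definition len :: "'n \<Rightarrow> 'n \<Rightarrow> bool" where
  "len \<sigma> l \<longleftrightarrow> (\<forall>i. i \<prec> l \<longleftrightarrow> (\<exists>a. entry \<sigma> i a))"

definition Seq :: "'n set" where
  "Seq = {\<sigma>. set_code \<sigma> \<and> (\<forall>x. elem x \<sigma> \<longrightarrow> (\<exists>i a. x = pair i a))
    \<and> (\<forall>i a b. entry \<sigma> i a \<and> entry \<sigma> i b \<longrightarrow> a = b) \<and> (\<exists>l. len \<sigma> l)}"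

definition initial :: "'n \<Rightarrow> 'n \<Rightarrow> bool" where
  "initial \<sigma> \<tau> \<longleftrightarrow> \<sigma> \<in> Seq \<and> \<tau> \<in> Seq \<and> (\<forall>i a. entry \<sigma> i a \<longrightarrow> entry \<tau> i a)"

definition incompatible :: "'n \<Rightarrow> 'n \<Rightarrow> bool" where
  "incompatible \<sigma> \<tau> \<longleftrightarrow> \<not> initial \<sigma> \<tau> \<and> \<not> initial \<tau> \<sigma>"

definition tree :: "'n set \<Rightarrow> bool" where
  "tree T \<longleftrightarrow> T \<in> Sets M \<and> T \<subseteq> Seq \<and> (\<forall>\<tau>\<in>T. \<forall>\<sigma>. initial \<sigma> \<tau> \<longrightarrow> \<sigma> \<in> T)"

text \<open>Functions on the numbers are sets of pairs belonging to the structure.\<close>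

definition is_function :: "'n set \<Rightarrow> bool" where
  "is_function f \<longleftrightarrow> f \<in> Sets M \<and> (\<forall>x\<in>f. \<exists>i a. x = pair i a) \<and> (\<forall>i. \<exists>!a. pair i a \<in> f)"

definition path :: "'n set \<Rightarrow> 'n set \<Rightarrow> bool" where
  "path T f \<longleftrightarrow> is_function f \<and>
    (\<forall>l. \<exists>\<sigma>\<in>T. len \<sigma> l \<and> (\<forall>i a. entry \<sigma> i a \<longrightarrow> pair i a \<in> f))"

definition well_founded :: "'n set \<Rightarrow> bool" where
  "well_founded T \<longleftrightarrow> \<not> (\<exists>f. path T f)"

definition at_most_one_path :: "'n set \<Rightarrow> bool" where
  "at_most_one_path T \<longleftrightarrow> (\<forall>f g. path T f \<and> path T g \<longrightarrow> f = g)"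

definition perfect_subtree :: "'n set \<Rightarrow> 'n set \<Rightarrow> bool" where
  "perfect_subtree S T \<longleftrightarrow> tree S \<and> S \<subseteq> T \<and>
    (\<forall>\<sigma>\<in>S. \<exists>\<tau>\<^sub>1\<in>S. \<exists>\<tau>\<^sub>2\<in>S. initial \<sigma> \<tau>\<^sub>1 \<and> initial \<sigma> \<tau>\<^sub>2 \<and> incompatible \<tau>\<^sub>1 \<tau>\<^sub>2)"

text \<open>The union is taken over perfect subtrees in the structure, and need not itself be one of
  its sets; being the perfect kernel is therefore a property of a set of the structure.\<close>

definition perfect_kernel :: "'n set \<Rightarrow> 'n set \<Rightarrow> bool" where
  "perfect_kernel K T \<longleftrightarrow> K \<in> Sets M \<and> K = \<Union>{S. perfect_subtree S T}"

text \<open>\<open>\<tau> = \<sigma> + 1\<close> and \<open>\<tau> = \<sigma>\<^sup>\<frown>a\<close>, as relations between codes.\<close>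

definition succ_seq :: "'n \<Rightarrow> 'n \<Rightarrow> bool" where
  "succ_seq \<sigma> \<tau> \<longleftrightarrow> \<sigma> \<in> Seq \<and> \<tau> \<in> Seq \<and> (\<exists>l. len \<sigma> l \<and> len \<tau> l)
    \<and> (\<forall>i a. entry \<sigma> i a \<longrightarrow> entry \<tau> i (a \<oplus> \<one>))"

definition snoc_seq :: "'n \<Rightarrow> 'n \<Rightarrow> 'n \<Rightarrow> bool" where
  "snoc_seq \<sigma> a \<tau> \<longleftrightarrow> initial \<sigma> \<tau> \<and> (\<exists>l. len \<sigma> l \<and> len \<tau> (l \<oplus> \<one>) \<and> entry \<tau> l a)"

definition plus :: "'n set \<Rightarrow> 'n set" where
  "plus T = {\<tau>. \<exists>\<sigma>\<in>T. succ_seq \<sigma> \<tau>}"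

definition star :: "'n set \<Rightarrow> 'n set" where
  "star T = plus T \<union> {\<tau>. \<exists>\<sigma>\<in>plus T. snoc_seq \<sigma> \<zero> \<tau>}"

end

end

(*
  A nonzero sequence code is uniquely of the form sigma + 1, so sigma |-> sigma + 1 is an isomorphism
  of T onto T^+ preserving initial segments, and f |-> f + 1 matches paths of T with paths of T^*.
  The extra nodes sigma^0 are leaves of T^*, the only nodes with an entry 0: they lie on no path and
  in no perfect subtree.

  What costs work is that sigma + 1, its inverse and restrictions exist as codes in a possibly
  nonstandard model. Goedel's argument gives this: Sigma_1 induction yields a common multiple m of
  1, ..., b and then a product of those moduli m (i + 1) + 1 (i < b) with i in a given set; the moduli
  are pairwise coprime, so the product codes the set. The inverse of sigma |-> sigma + 1 makes T^+
  and T^* Delta_1 rather than merely Sigma_1, hence sets of the model.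
*)

theory Submission imports Defs begin

text \<open>The axioms accept only Delta_0 matrices, while the coding notions quantify over all
  numbers. Much of the work is therefore to replace each notion by an equivalent whose quantifiers
  are bounded by the codes occurring in it. Comprehension further asks for a universal form of "some
  x in S is related to y". It is always obtained in the same way: a bounded condition on y
  guarantees that exactly one x is related to y, and then "some" and "every" agree. The related x is
  the predecessor for T^+, the parent for the leaves, and the successor when a perfect subtree of
  T^* is pulled back. The perfect kernel is a union that need not be a set of the model, so
  comprehension is never applied to it. The kernel claim rests instead on two facts valid for
  arbitrary collections of sequences: S |-> S^+ is injective and commutes with unions. Together with
  the pull-back, which shows that every perfect subtree of T^* is some S^+, they match the two
  unions.\<close>

context L2
begin

section \<open>Bounded definability\<close>

text \<open>De Bruijn formulas are never written out: the rules in \<open>definable\<close> follow the syntax of a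
  predicate of the assignment \<open>e\<close>.  The set assignment \<open>E\<close> is kept fixed throughout.\<close>

definition is_term :: "((nat \<Rightarrow> 'n) \<Rightarrow> 'n) \<Rightarrow> bool" where
  "is_term f \<longleftrightarrow> (\<exists>t. \<forall>e. tval e t = f e)"

definition bounded :: "(nat \<Rightarrow> 'n set) \<Rightarrow> ((nat \<Rightarrow> 'n) \<Rightarrow> bool) \<Rightarrow> bool" where
  "bounded E P \<longleftrightarrow> (\<exists>\<theta>. \<forall>e. bsat E e \<theta> \<longleftrightarrow> P e)"

named_theorems definable

lemma is_term_var [definable]: "is_term (\<lambda>e. e i)"
  unfolding is_term_def by (metis tval.simps(1))

lemma is_term_zero [definable]: "is_term (\<lambda>e. \<zero>)"
  unfolding is_term_def by (metis tval.simps(2))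

lemma is_term_one [definable]: "is_term (\<lambda>e. \<one>)"
  unfolding is_term_def by (metis tval.simps(3))

lemma is_term_add [definable]:
  "is_term f \<Longrightarrow> is_term g \<Longrightarrow> is_term (\<lambda>e. f e \<oplus> g e)"
  unfolding is_term_def by (metis tval.simps(4))

lemma is_term_mult [definable]:
  "is_term f \<Longrightarrow> is_term g \<Longrightarrow> is_term (\<lambda>e. f e \<otimes> g e)"
  unfolding is_term_def by (metis tval.simps(5))

lemma is_term_pair [definable]:
  "is_term f \<Longrightarrow> is_term g \<Longrightarrow> is_term (\<lambda>e. pair (f e) (g e))"
  unfolding pair_def by (intro definable)

text \<open>Entering a bounded quantifier puts the new variable at index 0, so a term in the outer
  variables reappears with its assignment shifted; raising every de Bruijn index by one expresses
  this.\<close>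

lemma is_term_shift:
  assumes "is_term f"
  shows "is_term (\<lambda>e. f (\<lambda>i. e (Suc i)))"
proof -
  obtain t where t: "\<And>e. tval e t = f e"
    using assms unfolding is_term_def by auto
  have "\<exists>t'. \<forall>e. tval e t' = tval (\<lambda>i. e (Suc i)) t"
  proof (induction t)
    case (Var i)
    show ?case by (rule exI [of _ "Var (Suc i)"]) simp
  next
    case Zero
    show ?case by (rule exI [of _ Zero]) simp
  next
    case One
    show ?case by (rule exI [of _ One]) simp
  next
    case (Add s t)
    then obtain s' t' where "\<forall>e. tval e s' = tval (\<lambda>i. e (Suc i)) s"
      "\<forall>e. tval e t' = tval (\<lambda>i. e (Suc i)) t" by blast
    then show ?case by (intro exI [of _ "Add s' t'"]) simp
  next
    case (Mult s t)
    then obtain s' t' where "\<forall>e. tval e s' = tval (\<lambda>i. e (Suc i)) s"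
      "\<forall>e. tval e t' = tval (\<lambda>i. e (Suc i)) t" by blast
    then show ?case by (intro exI [of _ "Mult s' t'"]) simp
  qed
  then show ?thesis
    unfolding is_term_def t .
qed

lemma bounded_eq [definable]:
  "is_term f \<Longrightarrow> is_term g \<Longrightarrow> bounded E (\<lambda>e. f e = g e)"
  unfolding is_term_def bounded_def by (metis bsat.simps(1))

lemma bounded_less [definable]:
  "is_term f \<Longrightarrow> is_term g \<Longrightarrow> bounded E (\<lambda>e. f e \<prec> g e)"
  unfolding is_term_def bounded_def by (metis bsat.simps(2))

text \<open>Set variables are never bound, so only sets that occur as values of \<open>E\<close> can
  be mentioned; which variable \<open>X\<close> names \<open>A\<close> has to be settled at each
  use.\<close>

lemma bounded_mem:
  "E X = A \<Longrightarrow> is_term f \<Longrightarrow> bounded E (\<lambda>e. f e \<in> A)"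
  unfolding is_term_def bounded_def by (metis bsat.simps(3))

lemma bounded_not [definable]:
  "bounded E P \<Longrightarrow> bounded E (\<lambda>e. \<not> P e)"
  unfolding bounded_def by (metis bsat.simps(4))

lemma bounded_conj [definable]:
  "bounded E P \<Longrightarrow> bounded E Q \<Longrightarrow> bounded E (\<lambda>e. P e \<and> Q e)"
  unfolding bounded_def by (metis bsat.simps(5))

lemma bounded_disj [definable]:
  assumes "bounded E P" "bounded E Q"
  shows "bounded E (\<lambda>e. P e \<or> Q e)"
proof -
  have "bounded E (\<lambda>e. \<not> (\<not> P e \<and> \<not> Q e))"
    by (intro definable assms)
  then show ?thesis by simp
qed

lemma bounded_imp [definable]:
  assumes "bounded E P" "bounded E Q"
  shows "bounded E (\<lambda>e. P e \<longrightarrow> Q e)"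
proof -
  have "bounded E (\<lambda>e. \<not> P e \<or> Q e)"
    by (intro definable assms)
  then show ?thesis by (simp only: imp_conv_disj)
qed

lemma bounded_iff [definable]:
  assumes "bounded E P" "bounded E Q"
  shows "bounded E (\<lambda>e. P e \<longleftrightarrow> Q e)"
proof -
  have "bounded E (\<lambda>e. (P e \<longrightarrow> Q e) \<and> (Q e \<longrightarrow> P e))"
    by (intro definable assms)
  then show ?thesis by (simp only: iff_conv_conj_imp)
qed

text \<open>\<open>Q\<close> takes the bound variable apart from the outer assignment; the premise
  reads both off one assignment, bound variable first. The bound \<open>t\<close> is evaluated in
  the outer assignment, in accordance with the scope convention of \<open>BAll\<close>.\<close>

lemma bounded_all [definable]:
  assumes "is_term t" and "bounded E (\<lambda>e. Q (e 0) (\<lambda>i. e (Suc i)))"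
  shows "bounded E (\<lambda>e. \<forall>x. x \<prec> t e \<longrightarrow> Q x e)"
proof -
  obtain s \<theta> where s: "\<And>e. tval e s = t e"
    and \<theta>: "\<And>e. bsat E e \<theta> \<longleftrightarrow> Q (e 0) (\<lambda>i. e (Suc i))"
    using assms unfolding is_term_def bounded_def by auto
  show ?thesis
    unfolding bounded_def by (rule exI [of _ "BAll s \<theta>"]) (simp add: s \<theta>)
qed

lemma bounded_ex [definable]:
  assumes "is_term t" and "bounded E (\<lambda>e. Q (e 0) (\<lambda>i. e (Suc i)))"
  shows "bounded E (\<lambda>e. \<exists>x. x \<prec> t e \<and> Q x e)"
proof -
  have "bounded E (\<lambda>e. \<not> (\<forall>x. x \<prec> t e \<longrightarrow> \<not> Q x e))"
    by (intro definable assms)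
  then show ?thesis by simp
qed

end

text \<open>Induction and comprehension are asserted only for assignments \<open>E\<close> with all
  values in \<open>Sets M\<close>, hence say nothing in a structure without sets.\<close>

locale inhabited_RCA0 = RCA0 M for M :: "'n L2_structure" (structure) +
  assumes Sets_nonempty: "Sets M \<noteq> {}"
begin

section \<open>Induction and comprehension for bounded predicates\<close>

lemma \<Sigma>1_induct:
  assumes E: "range E \<subseteq> Sets M"
    and P: "bounded E (\<lambda>e. P (e 0) (e 1) (e 2) (e 3) (e 4))"
    and zero: "\<exists>k. P k \<zero> a b c"
    and succ: "\<And>n k. P k n a b c \<Longrightarrow> \<exists>k. P k (n \<oplus> \<one>) a b c"
  shows "\<exists>k. P k n a b c"
proof -
  obtain \<theta> where \<theta>: "\<And>e. bsat E e \<theta> \<longleftrightarrow> P (e 0) (e 1) (e 2) (e 3) (e 4)"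
    using P unfolding bounded_def by auto
  \<comment> \<open>Behind the witness and the distinguished variable, \<open>a\<close>,
    \<open>b\<close>, \<open>c\<close> land at positions 2 to 4; an assignment is total, so
    \<open>c\<close> also fills the rest.\<close>
  let ?e = "case_nat a (case_nat b (case_nat c (\<lambda>_. c)))"
  have *: "sat_\<Sigma>1 \<theta> E ?e n \<longleftrightarrow> (\<exists>k. P k n a b c)" for n
    unfolding sat_\<Sigma>1_def \<theta> by (simp add: numeral_eq_Suc)
  have "\<forall>n. sat_\<Sigma>1 \<theta> E ?e n"
    by (rule \<Sigma>1_induction [OF E]) (use zero succ in \<open>auto simp: *\<close>)
  then show ?thesis by (simp add: *)
qed

text \<open>Assignments list the witness of the \<open>\<Sigma>\<^sup>0\<^sub>1\<close> formula first, then the distinguished variable; the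
  variant for bounded formulas ignores the witness, hence its indices start at \<open>1\<close>.\<close>

lemma bounded_induct:
  assumes E: "range E \<subseteq> Sets M"
    and P: "bounded E (\<lambda>e. P (e 1) (e 2) (e 3) (e 4))"
    and zero: "P \<zero> a b c"
    and succ: "\<And>n. P n a b c \<Longrightarrow> P (n \<oplus> \<one>) a b c"
  shows "P n a b c"
  using \<Sigma>1_induct [of E "\<lambda>k. P" a b c n] assms by simp

lemma \<Delta>1_set:
  assumes E: "range E \<subseteq> Sets M"
    and P: "bounded E (\<lambda>e. P (e 0) (e 1) (e 2) (e 3) (e 4))"
    and Q: "bounded E (\<lambda>e. Q (e 0) (e 1) (e 2) (e 3) (e 4))"
    and eq: "\<And>n. (\<exists>k. P k n a b c) \<longleftrightarrow> (\<forall>k. Q k n a b c)"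
  shows "{n. \<exists>k. P k n a b c} \<in> Sets M"
proof -
  obtain \<theta> where \<theta>: "\<And>e. bsat E e \<theta> \<longleftrightarrow> P (e 0) (e 1) (e 2) (e 3) (e 4)"
    using P unfolding bounded_def by auto
  obtain \<theta>' where \<theta>': "\<And>e. bsat E e \<theta>' \<longleftrightarrow> Q (e 0) (e 1) (e 2) (e 3) (e 4)"
    using Q unfolding bounded_def by auto
  let ?e = "case_nat a (case_nat b (case_nat c (\<lambda>_. c)))"
  have *: "sat_\<Sigma>1 \<theta> E ?e n \<longleftrightarrow> (\<exists>k. P k n a b c)"
    "sat_\<Pi>1 \<theta>' E ?e n \<longleftrightarrow> (\<forall>k. Q k n a b c)" for n
    unfolding sat_\<Sigma>1_def sat_\<Pi>1_def \<theta> \<theta>' by (simp_all add: numeral_eq_Suc)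
  have "\<exists>X\<in>Sets M. \<forall>n. n \<in> X \<longleftrightarrow> sat_\<Sigma>1 \<theta> E ?e n"
    by (rule \<Delta>1_comprehension [OF E, where \<theta>' = \<theta>']) (use eq in \<open>auto simp: *\<close>)
  then obtain X where "X \<in> Sets M" "\<And>n. n \<in> X \<longleftrightarrow> sat_\<Sigma>1 \<theta> E ?e n"
    by blast
  moreover from this have "X = {n. \<exists>k. P k n a b c}"
    by (auto simp: *)
  ultimately show ?thesis by simp
qed

lemma bounded_set:
  assumes "range E \<subseteq> Sets M"
    and "bounded E (\<lambda>e. P (e 1) (e 2) (e 3) (e 4))"
  shows "{n. P n a b c} \<in> Sets M"
  using \<Delta>1_set [of E "\<lambda>k. P" "\<lambda>k. P" a b c] assms by simp

section \<open>Arithmetic\<close>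

text \<open>Purely arithmetical formulas mention no set variable, but the induction axiom still has
  to be given an assignment of sets of the model.\<close>

definition some_sets :: "nat \<Rightarrow> 'n set" where
  "some_sets = (\<lambda>_. SOME X. X \<in> Sets M)"

lemma range_some_sets: "range some_sets \<subseteq> Sets M"
  unfolding some_sets_def using Sets_nonempty by (auto intro: someI)

lemmas arith_induct = bounded_induct [OF range_some_sets]

lemma add_assoc': "(a \<oplus> b) \<oplus> c = a \<oplus> (b \<oplus> c)"
\<comment> \<open>The first argument of \<open>P\<close> is the induction variable. The instance
  \<open>c = a\<close> gives a value to the remaining parameter slot; the same device recurs
  below.\<close>
proof (rule arith_induct [where P = "\<lambda>c a b _. (a \<oplus> b) \<oplus> c = a \<oplus> (b \<oplus> c)" and c = a])
  show "(a \<oplus> b) \<oplus> (n \<oplus> \<one>) = a \<oplus> (b \<oplus> (n \<oplus> \<one>))"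
    if "(a \<oplus> b) \<oplus> n = a \<oplus> (b \<oplus> n)" for n
    unfolding add_succ that ..
qed (auto intro!: definable simp: add_zero)

lemma zero_add: "\<zero> \<oplus> a = a"
proof (rule arith_induct [where P = "\<lambda>a _ _ _. \<zero> \<oplus> a = a" and a = a and b = a and c = a])
qed (auto intro!: definable simp: add_zero add_succ)

lemma succ_add: "(a \<oplus> \<one>) \<oplus> b = (a \<oplus> b) \<oplus> \<one>"
proof (rule arith_induct [where P = "\<lambda>b a _ _. (a \<oplus> \<one>) \<oplus> b = (a \<oplus> b) \<oplus> \<one>" and b = a and c = a])
qed (auto intro!: definable simp: add_zero add_succ)

lemma add_commute': "a \<oplus> b = b \<oplus> a"
proof (rule arith_induct [where P = "\<lambda>b a _ _. a \<oplus> b = b \<oplus> a" and b = a and c = a])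
qed (auto intro!: definable simp: add_zero add_succ zero_add succ_add)

lemma add_left_commute': "a \<oplus> (b \<oplus> c) = b \<oplus> (a \<oplus> c)"
  by (metis add_assoc' add_commute')

lemma distrib_left': "a \<otimes> (b \<oplus> c) = a \<otimes> b \<oplus> a \<otimes> c"
proof (rule arith_induct [where P = "\<lambda>c a b _. a \<otimes> (b \<oplus> c) = a \<otimes> b \<oplus> a \<otimes> c" and c = a])
  show "a \<otimes> (b \<oplus> (n \<oplus> \<one>)) = a \<otimes> b \<oplus> a \<otimes> (n \<oplus> \<one>)"
    if "a \<otimes> (b \<oplus> n) = a \<otimes> b \<oplus> a \<otimes> n" for n
    unfolding add_succ mult_succ that by (rule add_assoc')
qed (auto intro!: definable simp: add_zero mult_zero)

lemma mult_one: "a \<otimes> \<one> = a"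
  by (metis mult_succ mult_zero zero_add)

lemma mult_assoc': "(a \<otimes> b) \<otimes> c = a \<otimes> (b \<otimes> c)"
proof (rule arith_induct [where P = "\<lambda>c a b _. (a \<otimes> b) \<otimes> c = a \<otimes> (b \<otimes> c)" and c = a])
qed (auto intro!: definable simp: mult_succ mult_zero distrib_left' mult_one)

lemma zero_mult: "\<zero> \<otimes> a = \<zero>"
proof (rule arith_induct [where P = "\<lambda>a _ _ _. \<zero> \<otimes> a = \<zero>" and a = a and b = a and c = a])
qed (auto intro!: definable simp: add_zero mult_succ mult_zero)

lemma succ_mult: "(a \<oplus> \<one>) \<otimes> b = a \<otimes> b \<oplus> b"
proof (rule arith_induct [where P = "\<lambda>b a _ _. (a \<oplus> \<one>) \<otimes> b = a \<otimes> b \<oplus> b" and b = a and c = a])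
  show "(a \<oplus> \<one>) \<otimes> (n \<oplus> \<one>) = a \<otimes> (n \<oplus> \<one>) \<oplus> (n \<oplus> \<one>)"
    if "(a \<oplus> \<one>) \<otimes> n = a \<otimes> n \<oplus> n" for n
    unfolding mult_succ that by (simp only: add_assoc' add_left_commute' add_commute')
qed (auto intro!: definable simp: add_zero mult_zero)

lemma mult_commute': "a \<otimes> b = b \<otimes> a"
proof (rule arith_induct [where P = "\<lambda>b a _ _. a \<otimes> b = b \<otimes> a" and b = a and c = a])
qed (auto intro!: definable simp: mult_succ mult_zero zero_mult succ_mult)

lemma add_cancel: "c \<oplus> a = c \<oplus> b \<Longrightarrow> a = b"
proof -
  have "c \<oplus> a = c \<oplus> b \<longrightarrow> a = b"
  proof (rule arith_induct [where P = "\<lambda>c a b _. c \<oplus> a = c \<oplus> b \<longrightarrow> a = b" and c = a])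
  qed (auto intro!: definable simp: zero_add succ_add dest: succ_inject)
  then show "c \<oplus> a = c \<oplus> b \<Longrightarrow> a = b" by blast
qed

text \<open>The predecessor is the witness of a Sigma_1 induction; for this its quantifier is moved
  in front of the disjunction.\<close>

lemma zero_or_succ: "a = \<zero> \<or> (\<exists>b. a = b \<oplus> \<one>)"
proof -
  have "\<exists>b. a = \<zero> \<or> a = b \<oplus> \<one>"
  proof (rule \<Sigma>1_induct [OF range_some_sets, where P = "\<lambda>b a _ _ _. a = \<zero> \<or> a = b \<oplus> \<one>" and a = a and b = a and c = a])
  qed (auto intro!: definable)
  then show ?thesis by blast
qed

lemma less_add_succ: "a \<prec> a \<oplus> (d \<oplus> \<one>)"
proof (rule arith_induct [where P = "\<lambda>d a _ _. a \<prec> a \<oplus> (d \<oplus> \<one>)" and b = a and c = a])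
qed (auto intro!: definable simp: zero_add add_succ less_succ add_zero)

text \<open>The axioms describe \<open>\<prec>\<close> only at zero and at successors, so the
  difference has to be produced by Sigma_1 induction on the larger number.\<close>

lemma less_iff: "a \<prec> b \<longleftrightarrow> (\<exists>d. b = a \<oplus> (d \<oplus> \<one>))"
proof
  assume "a \<prec> b"
  moreover have "\<exists>d. a \<prec> b \<longrightarrow> b = a \<oplus> (d \<oplus> \<one>)"
  proof (rule \<Sigma>1_induct [OF range_some_sets,
        where P = "\<lambda>d b a _ _. a \<prec> b \<longrightarrow> b = a \<oplus> (d \<oplus> \<one>)" and b = a and c = a])
    show "\<exists>d'. a \<prec> n \<oplus> \<one> \<longrightarrow> n \<oplus> \<one> = a \<oplus> (d' \<oplus> \<one>)"
      if "a \<prec> n \<longrightarrow> n = a \<oplus> (d \<oplus> \<one>)" for n d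
      using that by (metis add_succ add_zero less_succ)
  qed (auto intro!: definable simp: not_less_zero)
  ultimately show "\<exists>d. b = a \<oplus> (d \<oplus> \<one>)" by blast
qed (auto simp: less_add_succ)

lemma less_linear': "a \<prec> b \<or> a = b \<or> b \<prec> a"
proof (rule arith_induct [where P = "\<lambda>b a _ _. a \<prec> b \<or> a = b \<or> b \<prec> a" and b = a and c = a])
  show "a \<prec> \<zero> \<or> a = \<zero> \<or> \<zero> \<prec> a"
    by (metis less_iff zero_add zero_or_succ)
  show "a \<prec> n \<oplus> \<one> \<or> a = n \<oplus> \<one> \<or> n \<oplus> \<one> \<prec> a" if "a \<prec> n \<or> a = n \<or> n \<prec> a" for n
  proof (cases "n \<prec> a")
    case True
    then obtain d where d: "a = n \<oplus> (d \<oplus> \<one>)" using less_iff by blast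
    show ?thesis
    proof (cases "d = \<zero>")
      case True
      then show ?thesis using d by (simp add: zero_add)
    next
      case False
      then obtain d' where "d = d' \<oplus> \<one>" using zero_or_succ by blast
      then have "a = (n \<oplus> \<one>) \<oplus> (d' \<oplus> \<one>)"
        unfolding d by (simp only: add_assoc' add_commute' add_left_commute')
      then show ?thesis by (simp add: less_add_succ)
    qed
  next
    case False
    then show ?thesis using that by (auto simp: less_succ)
  qed
qed (auto intro!: definable)

lemma less_irrefl': "\<not> a \<prec> a"
  by (metis add_cancel add_zero less_iff succ_neq_zero)

lemma less_trans': "a \<prec> b \<Longrightarrow> b \<prec> c \<Longrightarrow> a \<prec> c"
proof -
  assume "a \<prec> b" "b \<prec> c"
  then obtain d e where "b = a \<oplus> (d \<oplus> \<one>)" "c = b \<oplus> (e \<oplus> \<one>)"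
    using less_iff by blast
  then have "c = a \<oplus> ((d \<oplus> \<one> \<oplus> e) \<oplus> \<one>)"
    by (simp only: add_assoc')
  then show ?thesis by (simp only: less_add_succ)
qed

section \<open>Weak order, truncated subtraction and the ordered semiring\<close>

definition leq (infix \<open>\<preceq>\<close> 50) where
  "a \<preceq> b \<longleftrightarrow> a \<prec> b \<or> a = b"

text \<open>Truncated subtraction is needed only to make the structure an instance of \<open>linordered_semidom\<close>.\<close>

definition minus (infixl \<open>\<ominus>\<close> 65) where
  "a \<ominus> b = (if b \<preceq> a then THE d. a = b \<oplus> d else \<zero>)"

lemma leq_iff: "a \<preceq> b \<longleftrightarrow> (\<exists>d. b = a \<oplus> d)"
  unfolding leq_def less_iff by (metis add_zero zero_or_succ)

lemma add_minus: "(b \<oplus> d) \<ominus> b = d"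
proof -
  have "b \<preceq> b \<oplus> d" unfolding leq_iff by blast
  then show ?thesis unfolding minus_def by (auto dest: add_cancel)
qed

lemma minus_eq_zero:
  assumes "a \<preceq> b"
  shows "a \<ominus> b = \<zero>"
proof (cases "a = b")
  case True
  then show ?thesis using add_minus [of a \<zero>] by (simp add: add_zero)
next
  case False
  then have "\<not> b \<preceq> a"
    using assms less_trans' less_irrefl' unfolding leq_def by blast
  then show ?thesis unfolding minus_def by simp
qed

lemma leq_linear: "a \<preceq> b \<or> b \<preceq> a"
  unfolding leq_def using less_linear' by blast

lemma leq_add_cases:
  obtains d where "a = b \<oplus> d" | d where "b = a \<oplus> d"
  using leq_linear [of a b] unfolding leq_iff by blast

lemma zero_leq: "\<zero> \<preceq> a"
  unfolding leq_iff by (metis zero_add)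

lemma minus_minus: "a \<ominus> b \<ominus> c = a \<ominus> (b \<oplus> c)"
proof (cases rule: leq_add_cases [of a b])
  case (1 d)
  show ?thesis
  proof (cases rule: leq_add_cases [of d c])
    case (1 e)
    with \<open>a = b \<oplus> d\<close> have "a = (b \<oplus> c) \<oplus> e" by (simp add: add_assoc')
    then show ?thesis using 1 \<open>a = b \<oplus> d\<close> by (metis add_minus)
  next
    case (2 e)
    with \<open>a = b \<oplus> d\<close> have "b \<oplus> c = a \<oplus> e" by (simp add: add_assoc')
    then have "a \<ominus> (b \<oplus> c) = \<zero>" by (metis leq_iff minus_eq_zero)
    moreover have "d \<ominus> c = \<zero>" using 2 by (metis leq_iff minus_eq_zero)
    ultimately show ?thesis using \<open>a = b \<oplus> d\<close> by (simp add: add_minus)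
  qed
next
  case (2 d)
  then have "a \<preceq> b" "a \<preceq> b \<oplus> c" unfolding leq_iff by (auto simp: add_assoc')
  then show ?thesis by (simp add: minus_eq_zero zero_leq)
qed

lemma mult_minus: "a \<otimes> (b \<ominus> c) = a \<otimes> b \<ominus> a \<otimes> c"
proof (cases rule: leq_add_cases [of b c])
  case (1 d)
  then show ?thesis by (simp add: add_minus distrib_left')
next
  case (2 d)
  then have "b \<preceq> c" "a \<otimes> b \<preceq> a \<otimes> c" unfolding leq_iff by (auto simp: distrib_left')
  then show ?thesis by (simp add: minus_eq_zero mult_zero)
qed

lemma mult_less: "c \<otimes> a \<prec> c \<otimes> b" if ab: "a \<prec> b" and c: "\<zero> \<prec> c"
proof -
  obtain d e where b: "b = a \<oplus> (d \<oplus> \<one>)" and c: "c = e \<oplus> \<one>"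
    using ab c unfolding less_iff by (metis zero_add)
  have "c \<otimes> b = c \<otimes> a \<oplus> ((c \<otimes> d \<oplus> e) \<oplus> \<one>)"
    unfolding b distrib_left' mult_one by (simp only: c add_assoc')
  then show ?thesis by (simp only: less_add_succ)
qed

lemma mult_neq_zero: "a \<otimes> b \<noteq> \<zero>" if "a \<noteq> \<zero>" "b \<noteq> \<zero>"
  using mult_less [of \<zero> b a] that not_less_zero less_linear'
  by (metis mult_zero less_irrefl')

text \<open>Makes the general theory of ordered semirings available inside the model, notably
  divisibility \<open>N.dvd\<close>, on which the coprimality of the moduli relies.\<close>

sublocale N: linordered_semidom
  where zero = "\<zero>" and one = "\<one>" and plus = "(\<oplus>)" and times = "(\<otimes>)" and minus = "(\<ominus>)"
    and less_eq = "(\<preceq>)" and less = "(\<prec>)"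
proof (unfold_locales, goal_cases)
  case 1 show ?case by (rule add_assoc')
next
  case 2 show ?case by (rule add_commute')
next
  case 3 show ?case by (rule add_minus)
next
  case 4 show ?case by (rule minus_minus)
next
  case 5 show ?case unfolding leq_def using less_irrefl' less_trans' by blast
next
  case 6 show ?case by (simp add: leq_def)
next
  case 7 then show ?case unfolding leq_def using less_trans' by blast
next
  case 8 then show ?case unfolding leq_def using less_irrefl' less_trans' by blast
next
  case 9 then show ?case unfolding leq_iff by (auto simp: add_assoc')
next
  case 10 show ?case by (rule leq_linear)
next
  case 11 show ?case by (rule zero_add)
next
  case 12 show ?case by (rule mult_assoc')
next
  case 13 show ?case by (rule mult_commute')
next
  case (14 a b c) show ?case by (metis distrib_left' mult_commute')
next
  case 15 show ?case by (rule zero_mult)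
next
  case 16 show ?case by (rule mult_zero)
next
  case 17 then show ?case by (rule mult_less)
next
  case 18 show ?case by (metis mult_one mult_commute')
next
  case 19 show ?case by (metis succ_neq_zero zero_add)
next
  case 20 show ?case by (rule mult_minus)
next
  case 21 show ?case by (rule distrib_left')
next
  case 22 then show ?case by (rule mult_neq_zero)
next
  case 23 show ?case by (metis less_succ zero_add)
next
  case (24 b a) then show ?case unfolding leq_iff using add_minus add_commute' by metis
qed

section \<open>Codes of finite sets and sequences\<close>

lemma less_succ_iff: "a \<prec> b \<oplus> \<one> \<longleftrightarrow> a \<preceq> b"
  by (simp add: less_succ leq_def)

lemma leq_square: "a \<preceq> a \<otimes> a"
proof (cases "a = \<zero>")
  case False
  then obtain b where "a = b \<oplus> \<one>" using zero_or_succ by blast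
  then have "a \<otimes> a = a \<oplus> b \<otimes> a" by (simp add: succ_mult N.add.commute)
  then show ?thesis unfolding leq_iff by blast
qed (simp add: leq_iff zero_leq)

lemma leq_pair: "i \<preceq> pair i j" "j \<preceq> pair i j"
proof -
  show "i \<preceq> pair i j"
    unfolding pair_def leq_iff by (metis N.add.commute)
  have "j \<preceq> i \<oplus> j" unfolding leq_iff by (metis N.add.commute)
  also have "i \<oplus> j \<preceq> (i \<oplus> j) \<otimes> (i \<oplus> j)" by (rule leq_square)
  also have "\<dots> \<preceq> pair i j" unfolding pair_def leq_iff by blast
  finally show "j \<preceq> pair i j" .
qed

lemma pair_mono: "i \<preceq> i' \<Longrightarrow> j \<preceq> j' \<Longrightarrow> pair i j \<preceq> pair i' j'"
  unfolding pair_def by (intro N.add_mono N.mult_mono zero_leq)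

text \<open>With s = i + j, \<open>pair i j\<close> lies between s^2 and s^2 + s, hence below (s +
  1)^2.\<close>

lemma pair_less:
  assumes "i \<oplus> j \<prec> i' \<oplus> j'"
  shows "pair i j \<prec> pair i' j'"
proof -
  define s where "s = i \<oplus> j"
  obtain d where d: "i' \<oplus> j' = s \<oplus> (d \<oplus> \<one>)"
    using assms less_iff unfolding s_def by blast
  \<comment> \<open>The added number is (s + d + 1)^2 + i' - s^2 - i expanded; one summand s absorbs
    the subtraction of i and leaves j.\<close>
  have "pair i' j' = pair i j \<oplus>
      ((j \<oplus> s \<otimes> d \<oplus> d \<otimes> (s \<oplus> (d \<oplus> \<one>)) \<oplus> s \<oplus> d \<oplus> i') \<oplus> \<one>)"
    unfolding pair_def d s_def by (simp add: algebra_simps)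
  then show ?thesis by (simp only: less_add_succ)
qed

text \<open>Codes with different sums are strictly separated, so equal codes have equal sums;
  cancelling the square then gives the first component.\<close>

lemma pair_inject: "pair i j = pair i' j' \<longleftrightarrow> i = i' \<and> j = j'"
proof
  assume eq: "pair i j = pair i' j'"
  then have "i \<oplus> j = i' \<oplus> j'"
    using pair_less [of i j i' j'] pair_less [of i' j' i j] N.less_linear less_irrefl' by metis
  with eq show "i = i' \<and> j = j'"
    unfolding pair_def by (metis N.add_left_cancel)
qed simp

section \<open>Bounded equivalents of the coding notions\<close>

lemma divides_leq: "divides m n \<longleftrightarrow> (\<exists>q. q \<prec> n \<oplus> \<one> \<and> n = m \<otimes> q)"
proof
  assume "divides m n"
  then obtain q where q: "n = m \<otimes> q" unfolding divides_def by blast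
  show "\<exists>q. q \<prec> n \<oplus> \<one> \<and> n = m \<otimes> q"
  proof (cases "m = \<zero>")
    case True
    \<comment> \<open>Here \<open>n\<close> is zero and every number is a quotient; zero is one that
      respects the bound.\<close>
    then have "n = m \<otimes> \<zero>" using q by simp
    then show ?thesis using zero_leq less_succ_iff by blast
  next
    case False
    then obtain m' where "m = m' \<oplus> \<one>" using zero_or_succ by blast
    then have "n = q \<oplus> m' \<otimes> q" using q by (simp add: succ_mult N.add.commute)
    then show ?thesis using q unfolding less_succ_iff leq_iff by blast
  qed
qed (auto simp: divides_def)

lemma divides_iff_dvd: "divides m n \<longleftrightarrow> N.dvd m n"
  unfolding divides_def N.dvd_def ..

lemma leq_triple:
  assumes "c = pair k (pair m n)"
  shows "k \<preceq> c \<and> m \<preceq> c \<and> n \<preceq> c"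
  unfolding assms using leq_pair N.order_trans by metis

lemma triple_leq: "triple c \<longleftrightarrow>
  (\<exists>k. k \<prec> c \<oplus> \<one> \<and> (\<exists>m. m \<prec> c \<oplus> \<one> \<and> (\<exists>n. n \<prec> c \<oplus> \<one> \<and> c = pair k (pair m n))))"
  unfolding triple_def less_succ_iff using leq_triple by blast

lemma elem_leq: "elem i c \<longleftrightarrow>
  (\<exists>k. k \<prec> c \<oplus> \<one> \<and> (\<exists>m. m \<prec> c \<oplus> \<one> \<and> (\<exists>n. n \<prec> c \<oplus> \<one> \<and>
    c = pair k (pair m n) \<and> i \<prec> k \<and> divides (m \<otimes> (i \<oplus> \<one>) \<oplus> \<one>) n)))"
  unfolding elem_def less_succ_iff using leq_triple by blast

lemma elem_pair: "elem i (pair k (pair m n)) \<longleftrightarrow> i \<prec> k \<and> divides (m \<otimes> (i \<oplus> \<one>) \<oplus> \<one>) n"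
  unfolding elem_def by (auto simp: pair_inject)

lemma elem_less: "elem i c \<Longrightarrow> i \<prec> c"
  unfolding elem_def using leq_pair N.order.strict_trans2 by blast

lemma entry_less: "entry \<sigma> i a \<Longrightarrow> i \<prec> \<sigma> \<and> a \<prec> \<sigma>"
  unfolding entry_def using elem_less leq_pair N.order.strict_trans1 by blast

text \<open>All elements of \<open>c\<close>, and of any smaller code, are below \<open>c\<close>,
  so comparing the two codes there is enough.\<close>

lemma set_code_leq: "set_code c \<longleftrightarrow> triple c \<and>
  (\<forall>c'. c' \<prec> c \<longrightarrow> \<not> (triple c' \<and> (\<forall>i. i \<prec> c \<longrightarrow> (elem i c' \<longleftrightarrow> elem i c))))"
  unfolding set_code_def using elem_less N.order.strict_trans by meson

text \<open>The bound \<open>l \<oplus> \<sigma>\<close> exceeds both kinds of relevant index: those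
  below \<open>l\<close>, and those carrying an entry, which are below the code
  \<open>\<sigma>\<close>.\<close>

lemma len_leq: "len \<sigma> l \<longleftrightarrow>
  (\<forall>i. i \<prec> l \<oplus> \<sigma> \<longrightarrow> (i \<prec> l \<longleftrightarrow> (\<exists>a. a \<prec> \<sigma> \<and> entry \<sigma> i a)))"
proof -
  have "i \<prec> l \<oplus> \<sigma>" if "i \<prec> l" for i
    using that by (metis N.order.strict_trans2 leq_iff)
  moreover have "i \<prec> l \<oplus> \<sigma>" if "entry \<sigma> i a" for i a
    using entry_less [OF that] by (metis N.order.strict_trans2 leq_iff N.add.commute)
  ultimately show ?thesis unfolding len_def using entry_less by blast
qed

text \<open>Otherwise the number \<open>\<sigma>\<close> would itself be an index of an entry of
  \<open>\<sigma>\<close>, but such indices are smaller than the code.\<close>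

lemma len_le: "len \<sigma> l \<Longrightarrow> l \<preceq> \<sigma>"
  unfolding len_def using entry_less N.not_less less_irrefl' by metis

lemma Seq_leq: "\<sigma> \<in> Seq \<longleftrightarrow> set_code \<sigma>
  \<and> (\<forall>x. x \<prec> \<sigma> \<longrightarrow> elem x \<sigma> \<longrightarrow> (\<exists>i. i \<prec> \<sigma> \<and> (\<exists>a. a \<prec> \<sigma> \<and> x = pair i a)))
  \<and> (\<forall>i. i \<prec> \<sigma> \<longrightarrow> (\<forall>a. a \<prec> \<sigma> \<longrightarrow> (\<forall>b. b \<prec> \<sigma> \<longrightarrow> entry \<sigma> i a \<and> entry \<sigma> i b \<longrightarrow> a = b)))
  \<and> (\<exists>l. l \<prec> \<sigma> \<oplus> \<one> \<and> len \<sigma> l)"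
proof -
  have "(\<exists>i a. x = pair i a) \<longleftrightarrow> (\<exists>i. i \<prec> \<sigma> \<and> (\<exists>a. a \<prec> \<sigma> \<and> x = pair i a))" if "elem x \<sigma>" for x
    using entry_less that unfolding entry_def by blast
  moreover have "(\<forall>i a b. entry \<sigma> i a \<and> entry \<sigma> i b \<longrightarrow> a = b) \<longleftrightarrow>
    (\<forall>i. i \<prec> \<sigma> \<longrightarrow> (\<forall>a. a \<prec> \<sigma> \<longrightarrow> (\<forall>b. b \<prec> \<sigma> \<longrightarrow> entry \<sigma> i a \<and> entry \<sigma> i b \<longrightarrow> a = b)))"
    using entry_less by blast
  moreover have "(\<exists>l. len \<sigma> l) \<longleftrightarrow> (\<exists>l. l \<prec> \<sigma> \<oplus> \<one> \<and> len \<sigma> l)"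
    using len_le less_succ_iff by blast
  moreover have "(\<forall>x. elem x \<sigma> \<longrightarrow> (\<exists>i a. x = pair i a)) \<longleftrightarrow>
    (\<forall>x. x \<prec> \<sigma> \<longrightarrow> elem x \<sigma> \<longrightarrow> (\<exists>i. i \<prec> \<sigma> \<and> (\<exists>a. a \<prec> \<sigma> \<and> x = pair i a)))"
    using calculation(1) elem_less by blast
  ultimately show ?thesis unfolding Seq_def by simp
qed

lemma initial_leq: "initial \<sigma> \<tau> \<longleftrightarrow> \<sigma> \<in> Seq \<and> \<tau> \<in> Seq \<and>
  (\<forall>i. i \<prec> \<sigma> \<longrightarrow> (\<forall>a. a \<prec> \<sigma> \<longrightarrow> entry \<sigma> i a \<longrightarrow> entry \<tau> i a))"
  unfolding initial_def using entry_less by blast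

lemma succ_seq_leq: "succ_seq \<sigma> \<tau> \<longleftrightarrow> \<sigma> \<in> Seq \<and> \<tau> \<in> Seq \<and>
  (\<exists>l. l \<prec> \<sigma> \<oplus> \<one> \<and> (len \<sigma> l \<and> len \<tau> l)) \<and>
  (\<forall>i. i \<prec> \<sigma> \<longrightarrow> (\<forall>a. a \<prec> \<sigma> \<longrightarrow> entry \<sigma> i a \<longrightarrow> entry \<tau> i (a \<oplus> \<one>)))"
  unfolding succ_seq_def using entry_less len_le less_succ_iff by blast

lemma snoc_seq_leq: "snoc_seq \<sigma> a \<tau> \<longleftrightarrow> initial \<sigma> \<tau> \<and>
  (\<exists>l. l \<prec> \<sigma> \<oplus> \<one> \<and> (len \<sigma> l \<and> len \<tau> (l \<oplus> \<one>) \<and> entry \<tau> l a))"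
  unfolding snoc_seq_def using len_le less_succ_iff by blast

section \<open>Definability rules for the coding notions\<close>

context
  fixes f g h :: "(nat \<Rightarrow> 'n) \<Rightarrow> 'n"
  assumes f: "is_term f" and g: "is_term g" and h: "is_term h"
begin

text \<open>The bounded equivalents nest at most three quantifiers, so each term is needed shifted
  zero to three times. A notion with fewer than three arguments repeats one of them.\<close>

lemmas shifts1 = f g h is_term_shift [OF f] is_term_shift [OF g] is_term_shift [OF h]
lemmas shifts2 = shifts1 is_term_shift [OF is_term_shift [OF f]]
  is_term_shift [OF is_term_shift [OF g]] is_term_shift [OF is_term_shift [OF h]]
lemmas shifts = shifts2 is_term_shift [OF is_term_shift [OF is_term_shift [OF f]]]
  is_term_shift [OF is_term_shift [OF is_term_shift [OF g]]]
  is_term_shift [OF is_term_shift [OF is_term_shift [OF h]]]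

end

lemma bounded_divides [definable]:
  assumes "is_term f" "is_term g"
  shows "bounded E (\<lambda>e. divides (f e) (g e))"
  unfolding divides_leq
  by (intro definable shifts [OF assms(1,2,2)])

lemma bounded_triple [definable]:
  assumes "is_term f"
  shows "bounded E (\<lambda>e. triple (f e))"
  unfolding triple_leq
  by (intro definable shifts [OF assms assms assms])

lemma bounded_elem [definable]:
  assumes "is_term f" "is_term g"
  shows "bounded E (\<lambda>e. elem (f e) (g e))"
  unfolding elem_leq
  by (intro definable shifts [OF assms(1,2,2)])

lemma bounded_entry [definable]:
  assumes "is_term f" "is_term g" "is_term h"
  shows "bounded E (\<lambda>e. entry (f e) (g e) (h e))"
  unfolding entry_def
  by (intro definable shifts [OF assms])

lemma bounded_set_code [definable]:
  assumes "is_term f"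
  shows "bounded E (\<lambda>e. set_code (f e))"
  unfolding set_code_leq
  by (intro definable shifts [OF assms assms assms])

lemma bounded_len [definable]:
  assumes "is_term f" "is_term g"
  shows "bounded E (\<lambda>e. len (f e) (g e))"
  unfolding len_leq
  by (intro definable shifts [OF assms(1,2,2)])

lemma bounded_Seq [definable]:
  assumes "is_term f"
  shows "bounded E (\<lambda>e. f e \<in> Seq)"
  unfolding Seq_leq
  by (intro definable shifts [OF assms assms assms])

lemma bounded_initial [definable]:
  assumes "is_term f" "is_term g"
  shows "bounded E (\<lambda>e. initial (f e) (g e))"
  unfolding initial_leq
  by (intro definable shifts [OF assms(1,2,2)])

lemma bounded_succ_seq [definable]:
  assumes "is_term f" "is_term g"
  shows "bounded E (\<lambda>e. succ_seq (f e) (g e))"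
  unfolding succ_seq_leq
  by (intro definable shifts [OF assms(1,2,2)])

lemma bounded_snoc_seq [definable]:
  assumes "is_term f" "is_term g" "is_term h"
  shows "bounded E (\<lambda>e. snoc_seq (f e) (g e) (h e))"
  unfolding snoc_seq_leq
  by (intro definable shifts [OF assms])

text \<open>The parameters of \<open>P\<close> are at \<open>3, 4, 5\<close> because the proof puts \<open>P\<close> under one more quantifier.\<close>

lemma least_bounded:
  assumes E: "range E \<subseteq> Sets M"
    and P: "bounded E (\<lambda>e. P (e 0) (e 3) (e 4) (e 5))"
    and ex: "P n a b c"
  shows "\<exists>n. P n a b c \<and> (\<forall>m. m \<prec> n \<longrightarrow> \<not> P m a b c)"
proof (rule ccontr)
  assume none: "\<not> ?thesis"
  have "\<forall>m. m \<prec> k \<longrightarrow> \<not> P m a b c" for k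
  proof (rule bounded_induct [OF E, where P = "\<lambda>k a b c. \<forall>m. m \<prec> k \<longrightarrow> \<not> P m a b c"])
    have "bounded E (\<lambda>e. P (e 0) (e (Suc 2)) (e (Suc 3)) (e (Suc 4)))"
      using P by (simp add: numeral_eq_Suc)
    then show "bounded E (\<lambda>e. \<forall>m. m \<prec> e 1 \<longrightarrow> \<not> P m (e 2) (e 3) (e 4))"
      by (intro definable)
  qed (use none in \<open>auto simp: not_less_zero less_succ\<close>)
  then show False using ex less_succ by blast
qed

section \<open>Goedel coding of bounded sets\<close>

lemma common_multiple: "\<exists>m. m \<noteq> \<zero> \<and> (\<forall>j. j \<prec> b \<longrightarrow> divides (j \<oplus> \<one>) m)"
proof (rule \<Sigma>1_induct [OF range_some_sets,
      where P = "\<lambda>m b _ _ _. m \<noteq> \<zero> \<and> (\<forall>j. j \<prec> b \<longrightarrow> divides (j \<oplus> \<one>) m)"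
        and a = b and b = b and c = b])
  show "\<exists>m. m \<noteq> \<zero> \<and> (\<forall>j. j \<prec> \<zero> \<longrightarrow> divides (j \<oplus> \<one>) m)"
    using not_less_zero succ_neq_zero by blast
  show "\<exists>m'. m' \<noteq> \<zero> \<and> (\<forall>j. j \<prec> n \<oplus> \<one> \<longrightarrow> divides (j \<oplus> \<one>) m')"
    if "m \<noteq> \<zero> \<and> (\<forall>j. j \<prec> n \<longrightarrow> divides (j \<oplus> \<one>) m)" for n m
  proof (intro exI conjI allI impI)
    \<comment> \<open>This is the recursion of the factorial, without a factorial function. Being
      nonzero matters: with \<open>m\<close> zero every modulus would be one and divide
      everything.\<close>
    show "m \<otimes> (n \<oplus> \<one>) \<noteq> \<zero>" using that succ_neq_zero mult_neq_zero by blast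
    show "divides (j \<oplus> \<one>) (m \<otimes> (n \<oplus> \<one>))" if "j \<prec> n \<oplus> \<one>" for j
      using that \<open>m \<noteq> \<zero> \<and> _\<close> unfolding less_succ divides_iff_dvd
      by (auto intro: N.dvd_mult2)
  qed
qed (intro definable)

text \<open>No gcd is needed for the coprimality of the moduli: with \<open>A = m (i + 1) + 1\<close>, multiplication
  by \<open>m (i + 1)\<close> acts as \<open>-1\<close> modulo \<open>A\<close>, so \<open>m\<close> can be cancelled modulo \<open>A\<close>.\<close>

lemma dvd_modulus_cancel:
  assumes A: "A = m \<otimes> (i \<oplus> \<one>) \<oplus> \<one>" and "N.dvd A (m \<otimes> x)"
  shows "N.dvd A x"
proof -
  have "(i \<oplus> \<one>) \<otimes> (m \<otimes> x) \<oplus> x = A \<otimes> x"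
    unfolding A by (simp only: algebra_simps N.mult_1_left N.mult_1_right)
  moreover have "N.dvd A ((i \<oplus> \<one>) \<otimes> (m \<otimes> x))"
    using assms(2) by (rule N.dvd_mult)
  ultimately show ?thesis
    by (metis N.dvd_add_right_iff N.dvd_triv_left)
qed

text \<open>The moduli A and B of i and k differ by m (d + 1), where d + 1 is the distance of i and
  k. So A divides m (d + 1) n, and m cancels. As d + 1 divides m, A divides m n, and m cancels once
  more. The two cases avoid subtraction by adding the difference to the smaller modulus.\<close>

lemma moduli_coprime:
  assumes m: "\<And>j. j \<prec> b \<Longrightarrow> divides (j \<oplus> \<one>) m"
    and "i \<prec> b" "k \<prec> b" "i \<noteq> k"
    and "divides (m \<otimes> (i \<oplus> \<one>) \<oplus> \<one>) (n \<otimes> (m \<otimes> (k \<oplus> \<one>) \<oplus> \<one>))"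
  shows "divides (m \<otimes> (i \<oplus> \<one>) \<oplus> \<one>) n"
proof -
  define A where "A = m \<otimes> (i \<oplus> \<one>) \<oplus> \<one>"
  define B where "B = m \<otimes> (k \<oplus> \<one>) \<oplus> \<one>"
  have dvd: "N.dvd A (n \<otimes> B)" using assms(5) unfolding divides_iff_dvd A_def B_def .
  obtain d where d: "k = i \<oplus> (d \<oplus> \<one>) \<or> i = k \<oplus> (d \<oplus> \<one>)"
    using less_linear' [of i k] \<open>i \<noteq> k\<close> less_iff by blast
  have "d \<prec> b"
  proof -
    have "d \<prec> i \<or> d \<prec> k"
      using d less_add_succ [of d] by (metis N.add.assoc N.add.commute)
    then show ?thesis using assms(2,3) less_trans' by blast
  qed
  have "N.dvd A (m \<otimes> ((d \<oplus> \<one>) \<otimes> n))"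
    using d
  proof
    assume k: "k = i \<oplus> (d \<oplus> \<one>)"
    have "n \<otimes> B = A \<otimes> n \<oplus> m \<otimes> ((d \<oplus> \<one>) \<otimes> n)"
      unfolding A_def B_def k by (simp only: algebra_simps N.mult_1_left N.mult_1_right)
    then show ?thesis using dvd by (metis N.dvd_add_right_iff N.dvd_triv_left)
  next
    assume i: "i = k \<oplus> (d \<oplus> \<one>)"
    have "A \<otimes> n = n \<otimes> B \<oplus> m \<otimes> ((d \<oplus> \<one>) \<otimes> n)"
      unfolding A_def B_def i by (simp only: algebra_simps N.mult_1_left N.mult_1_right)
    then show ?thesis using dvd by (metis N.dvd_add_right_iff N.dvd_triv_left)
  qed
  then have "N.dvd A ((d \<oplus> \<one>) \<otimes> n)" by (rule dvd_modulus_cancel [OF A_def])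
  moreover obtain q where "m = (d \<oplus> \<one>) \<otimes> q"
    using m [OF \<open>d \<prec> b\<close>] unfolding divides_def by blast
  then have "m \<otimes> n = q \<otimes> ((d \<oplus> \<one>) \<otimes> n)" by (simp only: algebra_simps N.mult_1_left N.mult_1_right)
  ultimately have "N.dvd A (m \<otimes> n)" using N.dvd_mult by metis
  then show ?thesis
    unfolding divides_iff_dvd A_def [symmetric] by (rule dvd_modulus_cancel [OF A_def])
qed

text \<open>This makes one, the empty product, a code of the empty set, from which the construction
  of codes starts.\<close>

lemma modulus_not_divides_one:
  assumes "m \<noteq> \<zero>"
  shows "\<not> divides (m \<otimes> (i \<oplus> \<one>) \<oplus> \<one>) \<one>"
proof
  let ?x = "m \<otimes> (i \<oplus> \<one>)"
  assume "divides (?x \<oplus> \<one>) \<one>"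
  then obtain q where q: "\<one> = (?x \<oplus> \<one>) \<otimes> q" unfolding divides_def by blast
  moreover have "\<one> \<noteq> \<zero>" by (metis succ_neq_zero zero_add)
  ultimately have "q \<noteq> \<zero>" using mult_zero by metis
  then obtain q' where q': "q = q' \<oplus> \<one>" using zero_or_succ by blast
  have "\<zero> \<oplus> \<one> = (?x \<oplus> \<one>) \<otimes> (q' \<oplus> \<one>)" using q q' zero_add by metis
  also have "\<dots> = ((?x \<otimes> q' \<oplus> q') \<oplus> ?x) \<oplus> \<one>"
    by (simp add: mult_succ succ_mult add_succ)
  finally have "\<zero> = (?x \<otimes> q' \<oplus> q') \<oplus> ?x" by (rule succ_inject)
  then have "?x \<preceq> \<zero>" by (metis leq_iff N.add.commute)
  moreover have "?x \<noteq> \<zero>" using mult_neq_zero assms succ_neq_zero by blast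
  ultimately show False unfolding leq_def using not_less_zero by blast
qed

lemma set_code_exists:
  assumes X: "X \<in> Sets M"
  shows "\<exists>c. set_code c \<and> (\<forall>i. elem i c \<longleftrightarrow> i \<in> X \<and> i \<prec> b)"
proof -
  define E where "E = (\<lambda>_::nat. X)"
  have E: "range E \<subseteq> Sets M" unfolding E_def using X by auto
  obtain m where m: "m \<noteq> \<zero>" "\<And>j. j \<prec> b \<Longrightarrow> divides (j \<oplus> \<one>) m"
    using common_multiple by blast
  \<comment> \<open>The second \<open>i \<prec> b\<close> is there to be generalised: the induction
    varies it to \<open>i \<prec> k\<close>, while the moduli keep the range below \<open>b\<close>
    for which \<open>m\<close> was chosen.\<close>
  have "\<exists>n. \<forall>i. i \<prec> b \<longrightarrow> (divides (m \<otimes> (i \<oplus> \<one>) \<oplus> \<one>) n \<longleftrightarrow> i \<in> X \<and> i \<prec> b)"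
  proof (rule \<Sigma>1_induct [OF E,
        where P = "\<lambda>n k b m _. \<forall>i. i \<prec> b \<longrightarrow> (divides (m \<otimes> (i \<oplus> \<one>) \<oplus> \<one>) n \<longleftrightarrow> i \<in> X \<and> i \<prec> k)"
          and c = m])
    show "bounded E (\<lambda>e. \<forall>i. i \<prec> e 2 \<longrightarrow>
        (divides (e 3 \<otimes> (i \<oplus> \<one>) \<oplus> \<one>) (e 0) \<longleftrightarrow> i \<in> X \<and> i \<prec> e 1))"
      by (intro definable bounded_mem) (simp add: E_def)
    show "\<exists>n. \<forall>i. i \<prec> b \<longrightarrow> (divides (m \<otimes> (i \<oplus> \<one>) \<oplus> \<one>) n \<longleftrightarrow> i \<in> X \<and> i \<prec> \<zero>)"
      using modulus_not_divides_one [OF m(1)] not_less_zero by blast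
    show "\<exists>n'. \<forall>i. i \<prec> b \<longrightarrow> (divides (m \<otimes> (i \<oplus> \<one>) \<oplus> \<one>) n' \<longleftrightarrow> i \<in> X \<and> i \<prec> k \<oplus> \<one>)"
      if n: "\<forall>i. i \<prec> b \<longrightarrow> (divides (m \<otimes> (i \<oplus> \<one>) \<oplus> \<one>) n \<longleftrightarrow> i \<in> X \<and> i \<prec> k)" for n k
    proof (cases "k \<in> X \<and> k \<prec> b")
      case True
      then have kb: "k \<prec> b" by blast
      \<comment> \<open>The extra factor makes the modulus of \<open>k\<close> a divisor; by
        coprimality the status of every other modulus is unchanged.\<close>
      let ?n = "n \<otimes> (m \<otimes> (k \<oplus> \<one>) \<oplus> \<one>)"
      have "divides (m \<otimes> (i \<oplus> \<one>) \<oplus> \<one>) ?n \<longleftrightarrow> i \<in> X \<and> i \<prec> k \<oplus> \<one>" if i: "i \<prec> b" for i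
      proof (cases "i = k")
        case True
        then have "divides (m \<otimes> (i \<oplus> \<one>) \<oplus> \<one>) ?n"
          unfolding divides_iff_dvd by simp
        then show ?thesis using True \<open>k \<in> X \<and> _\<close> less_succ by blast
      next
        case False
        have "divides (m \<otimes> (i \<oplus> \<one>) \<oplus> \<one>) ?n \<longleftrightarrow> divides (m \<otimes> (i \<oplus> \<one>) \<oplus> \<one>) n"
        proof
          show "divides (m \<otimes> (i \<oplus> \<one>) \<oplus> \<one>) n" if "divides (m \<otimes> (i \<oplus> \<one>) \<oplus> \<one>) ?n"
            using moduli_coprime [OF m(2) i kb False that] .
        qed (unfold divides_iff_dvd, rule N.dvd_mult2)
        then show ?thesis using n i False less_succ by blast
      qed
      then show ?thesis by blast
    next
      case False
      \<comment> \<open>If \<open>k\<close> is not in \<open>X\<close>, nothing is to be added; if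
        \<open>k\<close> is not below \<open>b\<close>, no \<open>i\<close> below \<open>b\<close>
        equals it. Either way the old \<open>n\<close> serves.\<close>
      then show ?thesis using n less_succ by blast
    qed
  qed
  then obtain n where n: "\<And>i. i \<prec> b \<Longrightarrow> divides (m \<otimes> (i \<oplus> \<one>) \<oplus> \<one>) n \<longleftrightarrow> i \<in> X \<and> i \<prec> b"
    by blast
  define c where "c = pair b (pair m n)"
  have c: "elem i c \<longleftrightarrow> i \<in> X \<and> i \<prec> b" for i
    unfolding c_def elem_pair using n by blast
  \<comment> \<open>A \<open>set_code\<close> must be the least triple with its elements. Since
    elements are smaller than their code, having the same elements can be tested below
    \<open>c' \<oplus> c\<close>, which makes the least number principle for bounded predicates
    applicable.\<close>
  let ?P = "\<lambda>c' c. triple c' \<and> (\<forall>i. i \<prec> c' \<oplus> c \<longrightarrow> (elem i c' \<longleftrightarrow> elem i c))"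
  have "i \<prec> c' \<oplus> c" if "elem i c' \<or> elem i c" for i c'
    using that elem_less by (metis N.add.commute N.order.strict_trans2 leq_iff)
  then have P: "?P c' c \<longleftrightarrow> triple c' \<and> (\<forall>i. elem i c' \<longleftrightarrow> elem i c)" for c'
    by blast
  have "\<exists>c'. ?P c' c \<and> (\<forall>d. d \<prec> c' \<longrightarrow> \<not> ?P d c)"
  proof (rule least_bounded [OF E, where P = "\<lambda>c' c _ _. ?P c' c" and n = c and b = c and c = c])
    show "?P c c" unfolding c_def triple_def by blast
  qed (intro definable)
  then obtain c' where "?P c' c" "\<And>d. d \<prec> c' \<Longrightarrow> \<not> ?P d c" by blast
  then have "set_code c'" "\<And>i. elem i c' \<longleftrightarrow> elem i c"
    unfolding P set_code_def by auto
  then show ?thesis using c by blast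
qed

text \<open>The way from a definable function to a sequence code: \<open>v\<close> bounds the
  values, so the graph on the indices below \<open>l\<close> is a bounded set of pairs and has a
  code.\<close>

lemma Seq_exists:
  assumes X: "X \<in> Sets M"
    and total: "\<And>i. i \<prec> l \<Longrightarrow> \<exists>a. a \<prec> v \<and> pair i a \<in> X"
    and unique: "\<And>i a b. pair i a \<in> X \<Longrightarrow> pair i b \<in> X \<Longrightarrow> i \<prec> l \<Longrightarrow> a = b"
  obtains \<sigma> where "\<sigma> \<in> Seq" "len \<sigma> l" "\<And>i a. entry \<sigma> i a \<longleftrightarrow> i \<prec> l \<and> pair i a \<in> X"
proof -
  define E where "E = (\<lambda>_::nat. X)"
  have E: "range E \<subseteq> Sets M" unfolding E_def using X by auto
  \<comment> \<open>\<open>X\<close> may contain numbers that are not pairs, and pairs with index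
    outside \<open>l\<close>; neither may be an element of the code. The bound on \<open>a\<close>
    rests on \<open>a\<close> being at most \<open>pair i a\<close>.\<close>
  define Y where "Y = {x. x \<in> X \<and> (\<exists>i. i \<prec> l \<and> (\<exists>a. a \<prec> x \<oplus> \<one> \<and> x = pair i a))}"
  have "Y \<in> Sets M"
    unfolding Y_def
  proof (rule bounded_set [OF E,
        where P = "\<lambda>x l _ _. x \<in> X \<and> (\<exists>i. i \<prec> l \<and> (\<exists>a. a \<prec> x \<oplus> \<one> \<and> x = pair i a))"
          and b = l and c = l])
    show "bounded E (\<lambda>e. e 1 \<in> X \<and> (\<exists>i. i \<prec> e 2 \<and> (\<exists>a. a \<prec> e 1 \<oplus> \<one> \<and> e 1 = pair i a)))"
      by (intro definable bounded_mem) (simp add: E_def)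
  qed
  \<comment> \<open>Cutting off at \<open>pair l v\<close> loses nothing, because pairing is
    monotone in both arguments.\<close>
  then obtain \<sigma> where \<sigma>: "set_code \<sigma>" "\<And>x. elem x \<sigma> \<longleftrightarrow> x \<in> Y \<and> x \<prec> pair l v \<oplus> \<one>"
    using set_code_exists by blast
  have Y: "pair i a \<in> Y \<longleftrightarrow> i \<prec> l \<and> pair i a \<in> X" for i a
    unfolding Y_def less_succ_iff using leq_pair by (auto simp: pair_inject)
  have "pair i a \<prec> pair l v \<oplus> \<one>" if "i \<prec> l" "pair i a \<in> X" for i a
  proof -
    have "a \<prec> v" using total unique that by blast
    then show ?thesis using that(1) pair_mono unfolding less_succ_iff leq_def by blast
  qed
  then have entry: "entry \<sigma> i a \<longleftrightarrow> i \<prec> l \<and> pair i a \<in> X" for i a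
    unfolding entry_def \<sigma>(2) Y by blast
  have len: "len \<sigma> l" unfolding len_def entry using total by blast
  have "\<exists>i a. x = pair i a" if "elem x \<sigma>" for x
    using that unfolding \<sigma>(2) Y_def by blast
  moreover have "a = b" if "entry \<sigma> i a" "entry \<sigma> i b" for i a b
    using that unique unfolding entry by blast
  ultimately have "\<sigma> \<in> Seq"
    unfolding Seq_def using \<sigma>(1) len by blast
  then show ?thesis using that len entry by blast
qed

section \<open>Sequences and their successors\<close>

text \<open>Two codes with the same elements coincide because each is the least such code.\<close>

lemma Seq_eqI:
  assumes "\<sigma> \<in> Seq" "\<tau> \<in> Seq" and entry: "\<And>i a. entry \<sigma> i a \<longleftrightarrow> entry \<tau> i a"
  shows "\<sigma> = \<tau>"
proof -
  have code: "set_code \<sigma>" "set_code \<tau>"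
    and pairs: "\<And>x. elem x \<sigma> \<Longrightarrow> \<exists>i a. x = pair i a" "\<And>x. elem x \<tau> \<Longrightarrow> \<exists>i a. x = pair i a"
    using assms(1,2) unfolding Seq_def by blast+
  have "elem x \<sigma> \<longleftrightarrow> elem x \<tau>" for x
    using pairs entry unfolding entry_def by blast
  then show ?thesis
    using code less_linear' unfolding set_code_def by blast
qed

lemma entry_unique: "\<sigma> \<in> Seq \<Longrightarrow> entry \<sigma> i a \<Longrightarrow> entry \<sigma> i b \<Longrightarrow> a = b"
  unfolding Seq_def by blast

lemma Seq_len: "\<sigma> \<in> Seq \<Longrightarrow> \<exists>l. len \<sigma> l"
  unfolding Seq_def by blast

lemma len_unique: "len \<sigma> l \<Longrightarrow> len \<sigma> l' \<Longrightarrow> l = l'"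
  using less_linear' [of l l'] less_irrefl' unfolding len_def by blast

lemma len_entry: "len \<sigma> l \<Longrightarrow> i \<prec> l \<Longrightarrow> \<exists>a. entry \<sigma> i a"
  unfolding len_def by blast

lemma entry_len: "len \<sigma> l \<Longrightarrow> entry \<sigma> i a \<Longrightarrow> i \<prec> l"
  unfolding len_def by blast

lemma initial_refl: "\<sigma> \<in> Seq \<Longrightarrow> initial \<sigma> \<sigma>"
  unfolding initial_def by blast

lemma initial_Seq: "initial \<sigma> \<tau> \<Longrightarrow> \<sigma> \<in> Seq \<and> \<tau> \<in> Seq"
  unfolding initial_def by blast

lemma initial_entry_iff:
  assumes "initial \<sigma> \<tau>" "len \<sigma> l"
  shows "entry \<sigma> i a \<longleftrightarrow> i \<prec> l \<and> entry \<tau> i a"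
  using assms entry_unique unfolding initial_def len_def by blast

lemma initial_unique:
  assumes "initial \<sigma> \<tau>" "initial \<sigma>' \<tau>" "len \<sigma> l" "len \<sigma>' l"
  shows "\<sigma> = \<sigma>'"
proof (rule Seq_eqI)
  show "entry \<sigma> i a \<longleftrightarrow> entry \<sigma>' i a" for i a
    unfolding initial_entry_iff [OF assms(1,3)] initial_entry_iff [OF assms(2,4)] ..
qed (use assms(1,2) initial_Seq in auto)

lemma initial_len:
  assumes "initial \<sigma> \<tau>" "len \<sigma> l" "len \<tau> l'"
  shows "l \<preceq> l'"
proof (rule ccontr)
  assume "\<not> l \<preceq> l'"
  then have "l' \<prec> l" using less_linear' unfolding leq_def by blast
  then obtain a where "entry \<sigma> l' a" using assms(2) unfolding len_def by blast
  then have "entry \<tau> l' a" using assms(1) unfolding initial_def by blast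
  then show False using assms(3) less_irrefl' unfolding len_def by blast
qed

lemma initial_initial:
  assumes "initial \<sigma> \<tau>" "initial \<rho> \<tau>" "len \<sigma> l" "len \<rho> l'" "l \<preceq> l'"
  shows "initial \<sigma> \<rho>"
  unfolding initial_def
proof (intro conjI allI impI)
  show "entry \<rho> i a" if "entry \<sigma> i a" for i a
    using that initial_entry_iff [OF assms(1,3)] initial_entry_iff [OF assms(2,4)]
      N.order.strict_trans2 [OF _ assms(5)] by blast
qed (use assms(1,2) initial_Seq in auto)

text \<open>Supplies the parent of a node ending in zero when the leaves are shown to form a
  set.\<close>

lemma restriction_exists:
  assumes \<tau>: "\<tau> \<in> Seq" "len \<tau> l'" and l: "l \<preceq> l'"
  shows "\<exists>\<sigma>. initial \<sigma> \<tau> \<and> len \<sigma> l"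
proof -
  define X where "X = {x. elem x \<tau>}"
  have X_Sets: "X \<in> Sets M"
    unfolding X_def
    by (rule bounded_set [OF range_some_sets, where P = "\<lambda>x \<tau> _ _. elem x \<tau>" and b = \<tau> and c = \<tau>])
      (intro definable)
  have X: "pair i a \<in> X \<longleftrightarrow> entry \<tau> i a" for i a
    unfolding X_def entry_def by simp
  have total: "\<exists>a. a \<prec> \<tau> \<and> pair i a \<in> X" if i: "i \<prec> l" for i
    using \<tau>(2) N.order.strict_trans2 [OF i l] entry_less X unfolding len_def by blast
  have unique: "a = b" if "pair i a \<in> X" "pair i b \<in> X" for i a b
    using that entry_unique [OF \<tau>(1)] unfolding X by blast
  obtain \<sigma> where "\<sigma> \<in> Seq" "len \<sigma> l" "\<And>i a. entry \<sigma> i a \<longleftrightarrow> i \<prec> l \<and> pair i a \<in> X"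
    by (rule Seq_exists [where l = l, OF X_Sets total unique]) (assumption | rule that)+
  then show ?thesis using \<tau>(1) unfolding initial_def X by blast
qed

lemma succ_seq_Seq: "succ_seq \<sigma> \<tau> \<Longrightarrow> \<sigma> \<in> Seq \<and> \<tau> \<in> Seq"
  unfolding succ_seq_def by blast

lemma succ_seq_len: "succ_seq \<sigma> \<tau> \<Longrightarrow> len \<sigma> l \<longleftrightarrow> len \<tau> l"
  unfolding succ_seq_def using len_unique by blast

text \<open>\<open>succ_seq\<close> only sends entries forward; the converse comes from equal
  lengths, by which every entry of \<open>\<tau>\<close> lies over an entry of
  \<open>\<sigma>\<close>.\<close>

lemma succ_seq_entry_iff:
  assumes "succ_seq \<sigma> \<tau>"
  shows "entry \<tau> i b \<longleftrightarrow> (\<exists>a. b = a \<oplus> \<one> \<and> entry \<sigma> i a)"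
proof
  obtain l where l: "len \<sigma> l" "len \<tau> l" using assms unfolding succ_seq_def by blast
  assume b: "entry \<tau> i b"
  then obtain a where "entry \<sigma> i a" using entry_len [OF l(2)] len_entry [OF l(1)] by blast
  then show "\<exists>a. b = a \<oplus> \<one> \<and> entry \<sigma> i a"
    using assms b entry_unique unfolding succ_seq_def by blast
qed (use assms in \<open>auto simp: succ_seq_def\<close>)

lemma succ_seq_entry: "succ_seq \<sigma> \<tau> \<Longrightarrow> entry \<sigma> i a \<longleftrightarrow> entry \<tau> i (a \<oplus> \<one>)"
  using succ_seq_entry_iff succ_inject by blast

lemma succ_seq_nonzero: "succ_seq \<sigma> \<tau> \<Longrightarrow> \<not> entry \<tau> i \<zero>"
  using succ_seq_entry_iff succ_neq_zero by metis

lemma succ_seq_functional: "succ_seq \<sigma> \<tau> \<Longrightarrow> succ_seq \<sigma> \<tau>' \<Longrightarrow> \<tau> = \<tau>'"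
  by (rule Seq_eqI) (use succ_seq_Seq succ_seq_entry_iff in blast)+

lemma succ_seq_injective: "succ_seq \<sigma> \<tau> \<Longrightarrow> succ_seq \<sigma>' \<tau> \<Longrightarrow> \<sigma> = \<sigma>'"
  by (rule Seq_eqI) (use succ_seq_Seq succ_seq_entry in blast)+

lemma succ_seq_exists:
  assumes \<sigma>: "\<sigma> \<in> Seq"
  shows "\<exists>\<tau>. succ_seq \<sigma> \<tau>"
proof -
  obtain l where l: "len \<sigma> l" using Seq_len \<sigma> by blast
  define X where "X = {x. \<exists>i. i \<prec> \<sigma> \<and> (\<exists>a. a \<prec> \<sigma> \<and> x = pair i (a \<oplus> \<one>) \<and> entry \<sigma> i a)}"
  have X_Sets: "X \<in> Sets M"
    unfolding X_def
    by (rule bounded_set [OF range_some_sets,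
          where P = "\<lambda>x \<sigma> _ _. \<exists>i. i \<prec> \<sigma> \<and> (\<exists>a. a \<prec> \<sigma> \<and> x = pair i (a \<oplus> \<one>) \<and> entry \<sigma> i a)"
            and b = \<sigma> and c = \<sigma>])
      (intro definable)
  have X: "pair i b \<in> X \<longleftrightarrow> (\<exists>a. b = a \<oplus> \<one> \<and> entry \<sigma> i a)" for i b
    unfolding X_def using entry_less by (auto simp: pair_inject)
  \<comment> \<open>Entries of \<open>\<sigma>\<close> are below \<open>\<sigma>\<close>, so their
    successors are below \<open>\<sigma> \<oplus> \<one>\<close>, the value bound for the new
    code.\<close>
  have total: "\<exists>b. b \<prec> \<sigma> \<oplus> \<one> \<and> pair i b \<in> X" if i: "i \<prec> l" for i
  proof -
    obtain a where a: "entry \<sigma> i a" using len_entry [OF l i] by blast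
    have "a \<oplus> \<one> \<prec> \<sigma> \<oplus> \<one>" using entry_less [OF a] by simp
    then show ?thesis using X a by blast
  qed
  have unique: "a = b" if "pair i a \<in> X" "pair i b \<in> X" for i a b
    using that entry_unique [OF \<sigma>] unfolding X by blast
  obtain \<tau> where \<tau>: "\<tau> \<in> Seq" "len \<tau> l" "\<And>i b. entry \<tau> i b \<longleftrightarrow> i \<prec> l \<and> pair i b \<in> X"
    by (rule Seq_exists [where l = l, OF X_Sets total unique]) (assumption | rule that)+
  have "entry \<tau> i (a \<oplus> \<one>)" if "entry \<sigma> i a" for i a
    using that entry_len [OF l] unfolding \<tau>(3) X by blast
  then show ?thesis using \<sigma> l \<tau>(1,2) unfolding succ_seq_def by blast
qed

lemma pred_seq_exists:
  assumes \<tau>: "\<tau> \<in> Seq" and nonzero: "\<And>i. \<not> entry \<tau> i \<zero>"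
  shows "\<exists>\<sigma>. succ_seq \<sigma> \<tau>"
proof -
  obtain l where l: "len \<tau> l" using Seq_len \<tau> by blast
  define X where "X = {x. \<exists>i. i \<prec> \<tau> \<and> (\<exists>a. a \<prec> \<tau> \<and> x = pair i a \<and> entry \<tau> i (a \<oplus> \<one>))}"
  have X_Sets: "X \<in> Sets M"
    unfolding X_def
    by (rule bounded_set [OF range_some_sets,
          where P = "\<lambda>x \<tau> _ _. \<exists>i. i \<prec> \<tau> \<and> (\<exists>a. a \<prec> \<tau> \<and> x = pair i a \<and> entry \<tau> i (a \<oplus> \<one>))"
            and b = \<tau> and c = \<tau>])
      (intro definable)
  have less: "i \<prec> \<tau> \<and> a \<prec> \<tau>" if "entry \<tau> i (a \<oplus> \<one>)" for i a
    using entry_less [OF that] less_succ less_trans' by blast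
  then have X: "pair i a \<in> X \<longleftrightarrow> entry \<tau> i (a \<oplus> \<one>)" for i a
    unfolding X_def by (auto simp: pair_inject)
  have total: "\<exists>a. a \<prec> \<tau> \<and> pair i a \<in> X" if i: "i \<prec> l" for i
  proof -
    obtain b where b: "entry \<tau> i b" using len_entry [OF l i] by blast
    then obtain a where "b = a \<oplus> \<one>" using nonzero zero_or_succ [of b] by metis
    then show ?thesis using X b less by blast
  qed
  have unique: "a = b" if "pair i a \<in> X" "pair i b \<in> X" for i a b
    using that entry_unique [OF \<tau>] succ_inject unfolding X by blast
  obtain \<sigma> where "\<sigma> \<in> Seq" "len \<sigma> l" "\<And>i a. entry \<sigma> i a \<longleftrightarrow> i \<prec> l \<and> pair i a \<in> X"
    by (rule Seq_exists [where l = l, OF X_Sets total unique]) (assumption | rule that)+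
  then show ?thesis using \<tau> l unfolding succ_seq_def X by blast
qed

lemma initial_succ_iff:
  assumes "succ_seq \<sigma> \<sigma>'" "succ_seq \<tau> \<tau>'"
  shows "initial \<sigma>' \<tau>' \<longleftrightarrow> initial \<sigma> \<tau>"
  using assms unfolding initial_def
  by (simp add: succ_seq_Seq succ_seq_entry_iff) (metis succ_inject)

lemma incompatible_succ_iff:
  assumes "succ_seq \<sigma> \<sigma>'" "succ_seq \<tau> \<tau>'"
  shows "incompatible \<sigma>' \<tau>' \<longleftrightarrow> incompatible \<sigma> \<tau>"
  using assms unfolding incompatible_def by (simp add: initial_succ_iff)

lemma initial_of_succ:
  assumes "initial \<sigma>' \<tau>'" "succ_seq \<tau> \<tau>'"
  obtains \<sigma> where "succ_seq \<sigma> \<sigma>'" "initial \<sigma> \<tau>"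
proof -
  have "\<sigma>' \<in> Seq" "\<not> entry \<sigma>' i \<zero>" for i
    using assms succ_seq_nonzero unfolding initial_def by blast+
  then obtain \<sigma> where \<sigma>: "succ_seq \<sigma> \<sigma>'" using pred_seq_exists by blast
  then show ?thesis using that initial_succ_iff [OF \<sigma> assms(2)] assms(1) by blast
qed

section \<open>The trees \<open>T\<^sup>+\<close> and \<open>T\<^sup>*\<close>\<close>

lemma mem_plus_iff: "succ_seq \<sigma> \<tau> \<Longrightarrow> \<tau> \<in> plus S \<longleftrightarrow> \<sigma> \<in> S"
  unfolding plus_def using succ_seq_injective by blast

lemma plus_Seq: "plus S \<subseteq> Seq"
  unfolding plus_def using succ_seq_Seq by blast

lemma plus_nonzero: "\<tau> \<in> plus S \<Longrightarrow> \<not> entry \<tau> i \<zero>"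
  unfolding plus_def using succ_seq_nonzero by blast

text \<open>Stated for arbitrary collections of sequences, so that it also applies to a union of
  perfect subtrees.\<close>

lemma plus_subset_iff:
  assumes "S \<subseteq> Seq"
  shows "plus S \<subseteq> plus T \<longleftrightarrow> S \<subseteq> T"
proof
  assume le: "plus S \<subseteq> plus T"
  show "S \<subseteq> T"
  proof
    fix \<sigma> assume "\<sigma> \<in> S"
    moreover obtain \<tau> where "succ_seq \<sigma> \<tau>" using \<open>\<sigma> \<in> S\<close> assms succ_seq_exists by blast
    ultimately show "\<sigma> \<in> T" using le mem_plus_iff by blast
  qed
qed (auto simp: plus_def)

text \<open>For a sequence without entry zero the predecessor exists and is unique, so "some
  predecessor is in \<open>S\<close>" and "every predecessor is in \<open>S\<close>" agree. The
  condition on zeros keeps the universal form from holding vacuously.\<close>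

lemma plus_Sets:
  assumes S: "S \<in> Sets M"
  shows "plus S \<in> Sets M"
proof -
  define E where "E = (\<lambda>_::nat. S)"
  have E: "range E \<subseteq> Sets M" unfolding E_def using S by auto
  have "plus S = {\<tau>. \<exists>\<sigma>. \<sigma> \<in> S \<and> succ_seq \<sigma> \<tau>}" unfolding plus_def by blast
  also have "\<dots> \<in> Sets M"
  proof (rule \<Delta>1_set [OF E, where P = "\<lambda>\<sigma> \<tau> _ _ _. \<sigma> \<in> S \<and> succ_seq \<sigma> \<tau>"
        and Q = "\<lambda>\<sigma> \<tau> _ _ _. \<tau> \<in> Seq \<and> (\<forall>i. i \<prec> \<tau> \<longrightarrow> \<not> entry \<tau> i \<zero>) \<and> (succ_seq \<sigma> \<tau> \<longrightarrow> \<sigma> \<in> S)"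
        and a = \<zero> and b = \<zero> and c = \<zero>])
    show "bounded E (\<lambda>e. e 0 \<in> S \<and> succ_seq (e 0) (e 1))"
      by (intro definable bounded_mem) (simp add: E_def)
    show "bounded E (\<lambda>e. e 1 \<in> Seq \<and> (\<forall>i. i \<prec> e 1 \<longrightarrow> \<not> entry (e 1) i \<zero>) \<and>
        (succ_seq (e 0) (e 1) \<longrightarrow> e 0 \<in> S))"
      \<comment> \<open>\<open>Seq\<close> is handled as a definable notion rather than as a value
        of \<open>E\<close>, so the membership rule is pinned to \<open>S\<close>.\<close>
      by (intro definable bounded_mem [where X = 0 and A = S and E = E]) (simp add: E_def)
    show "(\<exists>\<sigma>. \<sigma> \<in> S \<and> succ_seq \<sigma> \<tau>) \<longleftrightarrow>
      (\<forall>\<sigma>. \<tau> \<in> Seq \<and> (\<forall>i. i \<prec> \<tau> \<longrightarrow> \<not> entry \<tau> i \<zero>) \<and> (succ_seq \<sigma> \<tau> \<longrightarrow> \<sigma> \<in> S))" for \<tau>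
      using pred_seq_exists [of \<tau>] entry_less [of \<tau>] succ_seq_nonzero [of _ \<tau>] succ_seq_Seq [of _ \<tau>]
        succ_seq_injective [of _ \<tau>]
      by metis
  qed
  finally show ?thesis .
qed

lemma tree_plus_iff:
  assumes "S \<in> Sets M" "S \<subseteq> Seq"
  shows "tree (plus S) \<longleftrightarrow> tree S"
proof
  assume tree: "tree (plus S)"
  have "\<sigma> \<in> S" if \<tau>: "\<tau> \<in> S" "initial \<sigma> \<tau>" for \<sigma> \<tau>
  proof -
    obtain \<sigma>' \<tau>' where "succ_seq \<sigma> \<sigma>'" "succ_seq \<tau> \<tau>'"
      using succ_seq_exists initial_Seq [OF \<tau>(2)] by blast
    then show ?thesis using \<tau> tree initial_succ_iff mem_plus_iff unfolding tree_def by blast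
  qed
  then show "tree S" unfolding tree_def using assms by blast
next
  assume tree: "tree S"
  have "\<sigma>' \<in> plus S" if \<tau>': "\<tau>' \<in> plus S" "initial \<sigma>' \<tau>'" for \<sigma>' \<tau>'
  proof -
    obtain \<tau> where \<tau>: "\<tau> \<in> S" "succ_seq \<tau> \<tau>'" using \<tau>'(1) unfolding plus_def by blast
    then obtain \<sigma> where "succ_seq \<sigma> \<sigma>'" "initial \<sigma> \<tau>" using initial_of_succ \<tau>'(2) by blast
    then show ?thesis using \<tau>(1) tree mem_plus_iff unfolding tree_def by blast
  qed
  then show "tree (plus S)"
    unfolding tree_def using plus_Sets [OF assms(1)] plus_Seq by blast
qed

text \<open>The parent of a sequence is its restriction by one entry: it exists, and it is
  determined by its length. Hence "some parent in \<open>S\<close>" can be replaced by "every parent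
  in \<open>S\<close>" once the last entry is known to be zero.\<close>

lemma snoc_Sets:
  assumes S: "S \<in> Sets M"
  shows "{\<tau>. \<exists>\<sigma>\<in>S. snoc_seq \<sigma> \<zero> \<tau>} \<in> Sets M"
proof -
  define E where "E = (\<lambda>_::nat. S)"
  have E: "range E \<subseteq> Sets M" unfolding E_def using S by auto
  have "{\<tau>. \<exists>\<sigma>\<in>S. snoc_seq \<sigma> \<zero> \<tau>} = {\<tau>. \<exists>\<sigma>. \<sigma> \<in> S \<and> snoc_seq \<sigma> \<zero> \<tau>}" by blast
  also have "\<dots> \<in> Sets M"
  proof (rule \<Delta>1_set [OF E, where P = "\<lambda>\<sigma> \<tau> _ _ _. \<sigma> \<in> S \<and> snoc_seq \<sigma> \<zero> \<tau>"
        and Q = "\<lambda>\<sigma> \<tau> _ _ _. \<tau> \<in> Seq \<and> (\<exists>l. l \<prec> \<tau> \<and> len \<tau> (l \<oplus> \<one>) \<and> entry \<tau> l \<zero>) \<and>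
          (snoc_seq \<sigma> \<zero> \<tau> \<longrightarrow> \<sigma> \<in> S)"
        and a = \<zero> and b = \<zero> and c = \<zero>])
    show "bounded E (\<lambda>e. e 0 \<in> S \<and> snoc_seq (e 0) \<zero> (e 1))"
      by (intro definable bounded_mem) (simp add: E_def)
    show "bounded E (\<lambda>e. e 1 \<in> Seq \<and> (\<exists>l. l \<prec> e 1 \<and> len (e 1) (l \<oplus> \<one>) \<and> entry (e 1) l \<zero>) \<and>
        (snoc_seq (e 0) \<zero> (e 1) \<longrightarrow> e 0 \<in> S))"
      by (intro definable bounded_mem [where X = 0 and A = S and E = E]) (simp add: E_def)
    show "(\<exists>\<sigma>. \<sigma> \<in> S \<and> snoc_seq \<sigma> \<zero> \<tau>) \<longleftrightarrow>
      (\<forall>\<sigma>. \<tau> \<in> Seq \<and> (\<exists>l. l \<prec> \<tau> \<and> len \<tau> (l \<oplus> \<one>) \<and> entry \<tau> l \<zero>) \<and>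
          (snoc_seq \<sigma> \<zero> \<tau> \<longrightarrow> \<sigma> \<in> S))" (is "?L \<longleftrightarrow> ?R") for \<tau>
    proof
      assume ?L
      then obtain \<sigma> l where \<sigma>: "\<sigma> \<in> S" "initial \<sigma> \<tau>" "len \<sigma> l" "len \<tau> (l \<oplus> \<one>)" "entry \<tau> l \<zero>"
        unfolding snoc_seq_def by blast
      have "\<rho> \<in> S" if \<rho>: "snoc_seq \<rho> \<zero> \<tau>" for \<rho>
      proof -
        obtain m where m: "initial \<rho> \<tau>" "len \<rho> m" "len \<tau> (m \<oplus> \<one>)"
          using \<rho> unfolding snoc_seq_def by blast
        then have "m = l" using len_unique \<sigma>(4) succ_inject by blast
        then show ?thesis using initial_unique \<sigma> m by blast
      qed
      then show ?R using \<sigma> entry_less initial_Seq by blast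
    next
      assume R: ?R
      then obtain l where l: "len \<tau> (l \<oplus> \<one>)" "entry \<tau> l \<zero>" by blast
      then obtain \<sigma> where "initial \<sigma> \<tau>" "len \<sigma> l"
        using R restriction_exists [of \<tau> "l \<oplus> \<one>" l] less_succ unfolding leq_def by blast
      then have "snoc_seq \<sigma> \<zero> \<tau>" using l unfolding snoc_seq_def by blast
      then show ?L using R by blast
    qed
  qed
  finally show ?thesis .
qed

lemma Un_Sets:
  assumes "A \<in> Sets M" "B \<in> Sets M"
  shows "A \<union> B \<in> Sets M"
proof -
  define E where "E = case_nat A (\<lambda>_. B)"
  have E: "range E \<subseteq> Sets M" unfolding E_def using assms by (auto split: nat.split)
  have "{x. x \<in> A \<or> x \<in> B} \<in> Sets M"
  proof (rule bounded_set [OF E, where P = "\<lambda>x _ _ _. x \<in> A \<or> x \<in> B"])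
    have "E 0 = A" "E 1 = B" unfolding E_def by auto
    then show "bounded E (\<lambda>e. e 1 \<in> A \<or> e 1 \<in> B)"
      by (intro bounded_disj bounded_mem is_term_var)
  qed
  then show ?thesis by (simp add: Un_def)
qed

lemma star_Seq: "star T \<subseteq> Seq"
  unfolding star_def snoc_seq_def using plus_Seq initial_Seq by blast

lemma star_nonzero: "\<tau> \<in> star T \<Longrightarrow> (\<And>i. \<not> entry \<tau> i \<zero>) \<Longrightarrow> \<tau> \<in> plus T"
  unfolding star_def snoc_seq_def by blast

text \<open>This is the leaf property: nodes of \<open>plus T\<close> have no zeros, so a zero can
  only be the appended, last entry.\<close>

lemma star_zero:
  assumes "\<tau> \<in> star T" "entry \<tau> i \<zero>"
  shows "len \<tau> (i \<oplus> \<one>)"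
proof -
  obtain \<rho> l where \<rho>: "\<rho> \<in> plus T" "initial \<rho> \<tau>" "len \<rho> l" "len \<tau> (l \<oplus> \<one>)"
    using assms plus_nonzero unfolding star_def snoc_seq_def by blast
  have "\<not> i \<prec> l"
    using assms(2) initial_entry_iff [OF \<rho>(2,3)] plus_nonzero [OF \<rho>(1)] by blast
  moreover have "i \<prec> l \<oplus> \<one>" using assms(2) \<rho>(4) unfolding len_def by blast
  ultimately have "i = l" using less_succ by blast
  then show ?thesis using \<rho>(4) by simp
qed

lemma tree_star:
  assumes "tree T"
  shows "tree (star T)"
proof -
  have T: "T \<in> Sets M" "T \<subseteq> Seq" using assms unfolding tree_def by auto
  then have plus: "tree (plus T)" using assms tree_plus_iff by blast
  have "\<sigma> \<in> star T" if \<tau>: "\<tau> \<in> star T" "initial \<sigma> \<tau>" for \<sigma> \<tau>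
  proof (cases "\<tau> \<in> plus T")
    case True
    then show ?thesis using plus \<tau>(2) unfolding tree_def star_def by blast
  next
    case False
    then obtain \<rho> l where \<rho>: "\<rho> \<in> plus T" "initial \<rho> \<tau>" "len \<rho> l" "len \<tau> (l \<oplus> \<one>)"
      using \<tau>(1) unfolding star_def snoc_seq_def by blast
    obtain s where s: "len \<sigma> s" using Seq_len initial_Seq \<tau>(2) by blast
    have "s \<preceq> l \<oplus> \<one>" using initial_len \<tau>(2) s \<rho>(4) by blast
    \<comment> \<open>An initial segment of a leaf either has full length and is the leaf itself, or
      already fits into the parent \<open>\<rho>\<close>.\<close>
    then consider "s = l \<oplus> \<one>" | "s \<preceq> l" unfolding leq_def less_succ by blast
    then show ?thesis
    proof cases
      case 1
      then have "\<sigma> = \<tau>"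
        using initial_unique [OF \<tau>(2) _ s] initial_refl initial_Seq [OF \<tau>(2)] \<rho>(4) by blast
      then show ?thesis using \<tau>(1) by simp
    next
      case 2
      then have "initial \<sigma> \<rho>" using initial_initial \<tau>(2) \<rho> s by blast
      then show ?thesis using plus \<rho>(1) unfolding tree_def star_def by blast
    qed
  qed
  moreover have "star T \<in> Sets M"
    unfolding star_def using plus_Sets [OF T(1)] by (intro Un_Sets snoc_Sets)
  ultimately show ?thesis unfolding tree_def using star_Seq by blast
qed

lemma plus_subset_star_iff:
  assumes "S \<subseteq> Seq"
  shows "plus S \<subseteq> star T \<longleftrightarrow> S \<subseteq> T"
proof -
  have "plus S \<subseteq> star T \<longleftrightarrow> plus S \<subseteq> plus T"
    using star_nonzero plus_nonzero unfolding star_def by blast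
  then show ?thesis using plus_subset_iff [OF assms] by simp
qed

section \<open>Perfect subtrees and the perfect kernel\<close>

lemma perfect_subtree_plus_iff:
  assumes S: "S \<in> Sets M" "S \<subseteq> Seq"
  shows "perfect_subtree (plus S) (star T) \<longleftrightarrow> perfect_subtree S T"
proof -
  let ?split = "\<lambda>S. \<forall>\<sigma>\<in>S. \<exists>\<tau>\<^sub>1\<in>S. \<exists>\<tau>\<^sub>2\<in>S. initial \<sigma> \<tau>\<^sub>1 \<and> initial \<sigma> \<tau>\<^sub>2 \<and> incompatible \<tau>\<^sub>1 \<tau>\<^sub>2"
  have "?split (plus S) \<longleftrightarrow> ?split S"
  proof
    assume split: "?split (plus S)"
    show "?split S"
    proof
      fix \<sigma> assume \<sigma>: "\<sigma> \<in> S"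
      then obtain \<sigma>' where \<sigma>': "succ_seq \<sigma> \<sigma>'" using succ_seq_exists S(2) by blast
      then have "\<sigma>' \<in> plus S" using \<sigma> mem_plus_iff by blast
      then obtain \<tau>' \<rho>' where *: "\<tau>' \<in> plus S" "\<rho>' \<in> plus S" "initial \<sigma>' \<tau>'" "initial \<sigma>' \<rho>'"
        "incompatible \<tau>' \<rho>'" using split by blast
      then obtain \<tau> \<rho> where "\<tau> \<in> S" "succ_seq \<tau> \<tau>'" "\<rho> \<in> S" "succ_seq \<rho> \<rho>'"
        unfolding plus_def by blast
      then show "\<exists>\<tau>\<in>S. \<exists>\<rho>\<in>S. initial \<sigma> \<tau> \<and> initial \<sigma> \<rho> \<and> incompatible \<tau> \<rho>"
        using * \<sigma>' initial_succ_iff incompatible_succ_iff by blast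
    qed
  next
    assume split: "?split S"
    show "?split (plus S)"
    proof
      fix \<sigma>' assume "\<sigma>' \<in> plus S"
      then obtain \<sigma> where \<sigma>: "\<sigma> \<in> S" "succ_seq \<sigma> \<sigma>'" unfolding plus_def by blast
      then obtain \<tau> \<rho> where *: "\<tau> \<in> S" "\<rho> \<in> S" "initial \<sigma> \<tau>" "initial \<sigma> \<rho>" "incompatible \<tau> \<rho>"
        using split by blast
      then obtain \<tau>' \<rho>' where succ: "succ_seq \<tau> \<tau>'" "succ_seq \<rho> \<rho>'"
        using succ_seq_exists S(2) by blast
      then have "\<tau>' \<in> plus S" "\<rho>' \<in> plus S" using *(1,2) mem_plus_iff by blast+
      moreover have "initial \<sigma>' \<tau>'" "initial \<sigma>' \<rho>'" "incompatible \<tau>' \<rho>'"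
        using * \<sigma> succ by (simp_all add: initial_succ_iff incompatible_succ_iff)
      ultimately show "\<exists>\<tau>\<in>plus S. \<exists>\<rho>\<in>plus S. initial \<sigma>' \<tau> \<and> initial \<sigma>' \<rho> \<and> incompatible \<tau> \<rho>"
        by blast
    qed
  qed
  then show ?thesis
    unfolding perfect_subtree_def tree_plus_iff [OF S] plus_subset_star_iff [OF S(2)] by blast
qed

text \<open>Every extension of \<open>\<tau>\<close> in \<open>P\<close> keeps the zero at
  \<open>i\<close>, hence has the same length \<open>i \<oplus> \<one>\<close> and equals
  \<open>\<tau>\<close>. A node with only one extension cannot split.\<close>

lemma perfect_subtree_star_nonzero:
  assumes P: "perfect_subtree P (star T)" and "\<tau> \<in> P"
  shows "\<not> entry \<tau> i \<zero>"
proof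
  assume zero: "entry \<tau> i \<zero>"
  obtain \<tau>\<^sub>1 \<tau>\<^sub>2 where *: "\<tau>\<^sub>1 \<in> P" "\<tau>\<^sub>2 \<in> P" "initial \<tau> \<tau>\<^sub>1" "initial \<tau> \<tau>\<^sub>2" "incompatible \<tau>\<^sub>1 \<tau>\<^sub>2"
    using assms unfolding perfect_subtree_def by blast
  have "\<rho> = \<tau>" if "\<rho> \<in> P" "initial \<tau> \<rho>" for \<rho>
  proof -
    have "\<tau> \<in> star T" "\<rho> \<in> star T" using P \<open>\<tau> \<in> P\<close> \<open>\<rho> \<in> P\<close> unfolding perfect_subtree_def by blast+
    moreover have "entry \<rho> i \<zero>" using that(2) zero unfolding initial_def by blast
    ultimately have "len \<tau> (i \<oplus> \<one>)" "len \<rho> (i \<oplus> \<one>)" using zero star_zero by blast+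
    then show ?thesis using initial_unique that(2) initial_refl initial_Seq by blast
  qed
  then have "\<tau>\<^sub>1 = \<tau>\<^sub>2" using * by blast
  then show False using * initial_refl initial_Seq unfolding incompatible_def by blast
qed

text \<open>The preimage of \<open>P\<close> is a set of the model because the successor of a
  sequence exists and is unique, which turns "some" into "every". It is mapped onto \<open>P\<close>
  because nodes of \<open>P\<close> have no zeros and so have predecessors.\<close>

lemma perfect_subtree_star:
  assumes P: "perfect_subtree P (star T)"
  shows "\<exists>S. perfect_subtree S T \<and> P = plus S"
proof -
  have "P \<in> Sets M" "P \<subseteq> Seq" using P unfolding perfect_subtree_def tree_def by auto
  define E where "E = (\<lambda>_::nat. P)"
  have E: "range E \<subseteq> Sets M" unfolding E_def using \<open>P \<in> Sets M\<close> by auto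
  define S where "S = {\<sigma>. \<exists>\<tau>. succ_seq \<sigma> \<tau> \<and> \<tau> \<in> P}"
  have "S \<in> Sets M"
    unfolding S_def
  proof (rule \<Delta>1_set [OF E, where P = "\<lambda>\<tau> \<sigma> _ _ _. succ_seq \<sigma> \<tau> \<and> \<tau> \<in> P"
        and Q = "\<lambda>\<tau> \<sigma> _ _ _. \<sigma> \<in> Seq \<and> (succ_seq \<sigma> \<tau> \<longrightarrow> \<tau> \<in> P)"
        and a = \<zero> and b = \<zero> and c = \<zero>])
    show "bounded E (\<lambda>e. succ_seq (e 1) (e 0) \<and> e 0 \<in> P)"
      by (intro definable bounded_mem) (simp add: E_def)
    show "bounded E (\<lambda>e. e 1 \<in> Seq \<and> (succ_seq (e 1) (e 0) \<longrightarrow> e 0 \<in> P))"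
      by (intro definable bounded_mem [where X = 0 and A = P and E = E]) (simp add: E_def)
    show "(\<exists>\<tau>. succ_seq \<sigma> \<tau> \<and> \<tau> \<in> P) \<longleftrightarrow> (\<forall>\<tau>. \<sigma> \<in> Seq \<and> (succ_seq \<sigma> \<tau> \<longrightarrow> \<tau> \<in> P))" for \<sigma>
      using succ_seq_exists [of \<sigma>] succ_seq_functional [of \<sigma>] succ_seq_Seq [of \<sigma>] by metis
  qed
  have "P \<subseteq> plus S"
  proof
    fix \<tau> assume "\<tau> \<in> P"
    then obtain \<sigma> where "succ_seq \<sigma> \<tau>"
      using pred_seq_exists perfect_subtree_star_nonzero [OF P] \<open>P \<subseteq> Seq\<close> by blast
    then show "\<tau> \<in> plus S" using \<open>\<tau> \<in> P\<close> unfolding plus_def S_def by blast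
  qed
  moreover have "plus S \<subseteq> P"
    unfolding plus_def S_def using succ_seq_functional by blast
  ultimately have eq: "P = plus S" by blast
  have "S \<subseteq> Seq" unfolding S_def using succ_seq_Seq by blast
  then have "perfect_subtree S T"
    using P perfect_subtree_plus_iff \<open>S \<in> Sets M\<close> unfolding eq by blast
  then show ?thesis using eq by blast
qed

text \<open>The perfect subtrees of \<open>star T\<close> are exactly the images under
  \<open>plus\<close> of those of \<open>T\<close>, and \<open>plus\<close>, being an image under a
  relation, commutes with unions.\<close>

lemma Union_perfect_subtrees_star:
  "\<Union>{P. perfect_subtree P (star T)} = plus (\<Union>{S. perfect_subtree S T})"
proof -
  have "perfect_subtree (plus S) (star T)" if "perfect_subtree S T" for S
  proof -
    have "S \<in> Sets M" "S \<subseteq> Seq" using that unfolding perfect_subtree_def tree_def by auto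
    then show ?thesis using that perfect_subtree_plus_iff by simp
  qed
  then have "{P. perfect_subtree P (star T)} = plus ` {S. perfect_subtree S T}"
    by (auto simp: image_iff dest: perfect_subtree_star)
  then show ?thesis by (auto simp: plus_def)
qed

lemma perfect_kernel_plus_iff:
  assumes K: "K \<in> Sets M" "K \<subseteq> Seq"
  shows "perfect_kernel (plus K) (star T) \<longleftrightarrow> perfect_kernel K T"
proof -
  let ?U = "\<Union>{S. perfect_subtree S T}"
  have "?U \<subseteq> Seq" unfolding perfect_subtree_def tree_def by blast
  \<comment> \<open>Only inclusion in \<open>Seq\<close> enters here, so it does not matter whether
    \<open>?U\<close> is a set of the model.\<close>
  then have "plus K = plus ?U \<longleftrightarrow> K = ?U"
    using plus_subset_iff K(2) by (metis subset_antisym order_refl)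
  then show ?thesis
    unfolding perfect_kernel_def Union_perfect_subtrees_star using K plus_Sets by blast
qed

section \<open>Paths\<close>

definition increment :: "'n set \<Rightarrow> 'n set" where
  "increment f = {x. \<exists>i a. x = pair i (a \<oplus> \<one>) \<and> pair i a \<in> f}"

text \<open>Pairs with value zero are dropped, so the result is total only for functions without the
  value zero.\<close>

definition decrement :: "'n set \<Rightarrow> 'n set" where
  "decrement g = {x. \<exists>i a. x = pair i a \<and> pair i (a \<oplus> \<one>) \<in> g}"

lemma pair_mem_increment: "pair i b \<in> increment f \<longleftrightarrow> (\<exists>a. b = a \<oplus> \<one> \<and> pair i a \<in> f)"
  unfolding increment_def by (auto simp: pair_inject)

lemma pair_mem_decrement: "pair i a \<in> decrement g \<longleftrightarrow> pair i (a \<oplus> \<one>) \<in> g"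
  unfolding decrement_def by (auto simp: pair_inject)

lemma increment_Sets:
  assumes "f \<in> Sets M"
  shows "increment f \<in> Sets M"
proof -
  define E where "E = (\<lambda>_::nat. f)"
  have E: "range E \<subseteq> Sets M" unfolding E_def using assms by auto
  have le: "i \<preceq> pair i (a \<oplus> \<one>) \<and> a \<preceq> pair i (a \<oplus> \<one>)" for i a
    using leq_pair N.order_trans leq_iff by blast
  have "increment f = {x. \<exists>i. i \<prec> x \<oplus> \<one> \<and> (\<exists>a. a \<prec> x \<oplus> \<one> \<and> x = pair i (a \<oplus> \<one>) \<and> pair i a \<in> f)}"
    unfolding increment_def less_succ_iff using le by blast
  also have "\<dots> \<in> Sets M"
  proof (rule bounded_set [OF E, where P = "\<lambda>x _ _ _. \<exists>i. i \<prec> x \<oplus> \<one> \<and>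
        (\<exists>a. a \<prec> x \<oplus> \<one> \<and> x = pair i (a \<oplus> \<one>) \<and> pair i a \<in> f)"])
    show "bounded E (\<lambda>e. \<exists>i. i \<prec> e 1 \<oplus> \<one> \<and>
        (\<exists>a. a \<prec> e 1 \<oplus> \<one> \<and> e 1 = pair i (a \<oplus> \<one>) \<and> pair i a \<in> f))"
      by (intro definable bounded_mem) (simp add: E_def)
  qed
  finally show ?thesis .
qed

lemma decrement_Sets:
  assumes "g \<in> Sets M"
  shows "decrement g \<in> Sets M"
proof -
  define E where "E = (\<lambda>_::nat. g)"
  have E: "range E \<subseteq> Sets M" unfolding E_def using assms by auto
  have "decrement g = {x. \<exists>i. i \<prec> x \<oplus> \<one> \<and> (\<exists>a. a \<prec> x \<oplus> \<one> \<and> x = pair i a \<and> pair i (a \<oplus> \<one>) \<in> g)}"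
    unfolding decrement_def less_succ_iff using leq_pair by blast
  also have "\<dots> \<in> Sets M"
  proof (rule bounded_set [OF E, where P = "\<lambda>x _ _ _. \<exists>i. i \<prec> x \<oplus> \<one> \<and>
        (\<exists>a. a \<prec> x \<oplus> \<one> \<and> x = pair i a \<and> pair i (a \<oplus> \<one>) \<in> g)"])
    show "bounded E (\<lambda>e. \<exists>i. i \<prec> e 1 \<oplus> \<one> \<and>
        (\<exists>a. a \<prec> e 1 \<oplus> \<one> \<and> e 1 = pair i a \<and> pair i (a \<oplus> \<one>) \<in> g))"
      by (intro definable bounded_mem) (simp add: E_def)
  qed
  finally show ?thesis .
qed

lemma function_value: "is_function f \<Longrightarrow> \<exists>a. pair i a \<in> f"
  unfolding is_function_def by blast

lemma function_unique: "is_function f \<Longrightarrow> pair i a \<in> f \<Longrightarrow> pair i b \<in> f \<Longrightarrow> a = b"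
  unfolding is_function_def by blast

lemma function_pairs: "is_function f \<Longrightarrow> x \<in> f \<Longrightarrow> \<exists>i a. x = pair i a"
  unfolding is_function_def by blast

lemma pair_set_eqI:
  assumes "\<And>x. x \<in> A \<Longrightarrow> \<exists>i a. x = pair i a" "\<And>x. x \<in> B \<Longrightarrow> \<exists>i a. x = pair i a"
    and "\<And>i a. pair i a \<in> A \<longleftrightarrow> pair i a \<in> B"
  shows "A = B"
proof (rule set_eqI)
  show "x \<in> A \<longleftrightarrow> x \<in> B" for x
    using assms(1) [of x] assms(2) [of x] assms(3) by metis
qed

lemma decrement_increment:
  assumes "is_function f"
  shows "decrement (increment f) = f"
proof (rule pair_set_eqI)
  show "pair i a \<in> decrement (increment f) \<longleftrightarrow> pair i a \<in> f" for i a
    unfolding pair_mem_decrement pair_mem_increment using succ_inject by blast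
qed (use function_pairs [OF assms] in \<open>auto simp: decrement_def\<close>)

lemma increment_decrement:
  assumes "is_function g" and nonzero: "\<And>i. pair i \<zero> \<notin> g"
  shows "increment (decrement g) = g"
proof (rule pair_set_eqI)
  show "pair i b \<in> increment (decrement g) \<longleftrightarrow> pair i b \<in> g" for i b
    unfolding pair_mem_decrement pair_mem_increment using nonzero zero_or_succ [of b] by metis
qed (use function_pairs [OF assms(1)] in \<open>auto simp: increment_def\<close>)

lemma path_increment:
  assumes T: "T \<subseteq> Seq" and f: "path T f"
  shows "path (star T) (increment f)"
  unfolding path_def
proof (intro conjI allI)
  have fun_f: "is_function f" using f unfolding path_def by blast
  show "is_function (increment f)"
    unfolding is_function_def
  proof (intro conjI ballI allI)
    show "increment f \<in> Sets M" using increment_Sets fun_f unfolding is_function_def by blast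
    show "\<exists>i a. x = pair i a" if "x \<in> increment f" for x
      using that unfolding increment_def by blast
    fix i
    obtain a where a: "pair i a \<in> f" using function_value fun_f by blast
    show "\<exists>!b. pair i b \<in> increment f"
    proof (rule ex1I)
      show "pair i (a \<oplus> \<one>) \<in> increment f" unfolding pair_mem_increment using a by blast
      show "b = a \<oplus> \<one>" if "pair i b \<in> increment f" for b
        using that function_unique [OF fun_f a] unfolding pair_mem_increment by blast
    qed
  qed
  fix l
  obtain \<sigma> where \<sigma>: "\<sigma> \<in> T" "len \<sigma> l" "\<And>i a. entry \<sigma> i a \<Longrightarrow> pair i a \<in> f"
    using f unfolding path_def by blast
  then obtain \<tau> where \<tau>: "succ_seq \<sigma> \<tau>" using succ_seq_exists T by blast
  have "\<tau> \<in> star T" using \<tau> \<sigma>(1) unfolding star_def plus_def by blast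
  moreover have "len \<tau> l" using succ_seq_len \<tau> \<sigma>(2) by blast
  moreover have "pair i b \<in> increment f" if "entry \<tau> i b" for i b
    using that \<sigma>(3) unfolding succ_seq_entry_iff [OF \<tau>] pair_mem_increment by blast
  ultimately show "\<exists>\<tau>\<in>star T. len \<tau> l \<and> (\<forall>i a. entry \<tau> i a \<longrightarrow> pair i a \<in> increment f)"
    by blast
qed

lemma path_star_nonzero:
  assumes g: "path (star T) g"
  shows "pair i \<zero> \<notin> g"
proof
  assume zero: "pair i \<zero> \<in> g"
  \<comment> \<open>The length is one more than a node with a zero at \<open>i\<close> can
    have.\<close>
  obtain \<sigma> where \<sigma>: "\<sigma> \<in> star T" "len \<sigma> (i \<oplus> \<one> \<oplus> \<one>)" "\<And>j a. entry \<sigma> j a \<Longrightarrow> pair j a \<in> g"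
    using g unfolding path_def by blast
  have "i \<prec> i \<oplus> \<one> \<oplus> \<one>" by (simp add: less_succ)
  then obtain a where a: "entry \<sigma> i a" using len_entry [OF \<sigma>(2)] by blast
  have "is_function g" using g unfolding path_def by blast
  then have "a = \<zero>" using function_unique [OF _ \<sigma>(3) [OF a] zero] by blast
  then have "len \<sigma> (i \<oplus> \<one>)" using star_zero \<sigma>(1) a by blast
  then have "i \<oplus> \<one> = i \<oplus> \<one> \<oplus> \<one>" using len_unique \<sigma>(2) by blast
  moreover have "i \<oplus> \<one> \<prec> i \<oplus> \<one> \<oplus> \<one>" by (simp add: less_succ)
  ultimately show False using less_irrefl' by simp
qed

lemma path_decrement:
  assumes g: "path (star T) g"
  shows "path T (decrement g)"
  unfolding path_def
proof (intro conjI allI)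
  have fun_g: "is_function g" using g unfolding path_def by blast
  show "is_function (decrement g)"
    unfolding is_function_def
  proof (intro conjI ballI allI)
    show "decrement g \<in> Sets M" using decrement_Sets fun_g unfolding is_function_def by blast
    show "\<exists>i a. x = pair i a" if "x \<in> decrement g" for x
      using that unfolding decrement_def by blast
    fix i
    obtain b where b: "pair i b \<in> g" using function_value fun_g by blast
    then obtain a where "b = a \<oplus> \<one>" using path_star_nonzero [OF g] zero_or_succ [of b] by metis
    then have a: "pair i (a \<oplus> \<one>) \<in> g" using b by simp
    show "\<exists>!a. pair i a \<in> decrement g"
    proof (rule ex1I)
      show "pair i a \<in> decrement g" unfolding pair_mem_decrement by (rule a)
      show "a' = a" if "pair i a' \<in> decrement g" for a'
        using that function_unique [OF fun_g a] succ_inject unfolding pair_mem_decrement by blast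
    qed
  qed
  fix l
  obtain \<tau> where \<tau>: "\<tau> \<in> star T" "len \<tau> l" "\<And>i a. entry \<tau> i a \<Longrightarrow> pair i a \<in> g"
    using g unfolding path_def by blast
  \<comment> \<open>The entries of \<open>\<tau>\<close> are values of \<open>g\<close>, which omits
    zero, so \<open>\<tau>\<close> is not one of the leaves.\<close>
  then have "\<tau> \<in> plus T" using star_nonzero path_star_nonzero [OF g] by blast
  then obtain \<sigma> where \<sigma>: "\<sigma> \<in> T" "succ_seq \<sigma> \<tau>" unfolding plus_def by blast
  have "len \<sigma> l" using succ_seq_len \<sigma>(2) \<tau>(2) by blast
  moreover have "pair i a \<in> decrement g" if "entry \<sigma> i a" for i a
    using that \<tau>(3) unfolding succ_seq_entry [OF \<sigma>(2)] pair_mem_decrement by blast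
  ultimately show "\<exists>\<sigma>\<in>T. len \<sigma> l \<and> (\<forall>i a. entry \<sigma> i a \<longrightarrow> pair i a \<in> decrement g)"
    using \<sigma>(1) by blast
qed

lemma well_founded_star_iff:
  assumes "T \<subseteq> Seq"
  shows "well_founded (star T) \<longleftrightarrow> well_founded T"
  unfolding well_founded_def using path_increment [OF assms] path_decrement by blast

text \<open>Either map carries two paths to two paths, equal by assumption, and the other map
  recovers the originals. For paths of \<open>star T\<close> the recovery relies on their omitting
  the value zero.\<close>

lemma at_most_one_path_star_iff:
  assumes "T \<subseteq> Seq"
  shows "at_most_one_path (star T) \<longleftrightarrow> at_most_one_path T"
proof
  assume "at_most_one_path (star T)"
  then show "at_most_one_path T"
    unfolding at_most_one_path_def
    by (metis path_increment [OF assms] decrement_increment path_def)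
next
  assume "at_most_one_path T"
  then show "at_most_one_path (star T)"
    unfolding at_most_one_path_def
    by (metis path_decrement path_star_nonzero increment_decrement path_def)
qed

end

theorem theorem6:
  fixes M :: "'n L2_structure" and T :: "'n set"
  assumes "RCA0 M"
    and "L2.tree M T"
  shows "L2.tree M (L2.star M T)
    \<and> (L2.well_founded M T \<longleftrightarrow> L2.well_founded M (L2.star M T))
    \<and> (L2.at_most_one_path M T \<longleftrightarrow> L2.at_most_one_path M (L2.star M T))
    \<and> (\<forall>S\<in>Sets M. S \<subseteq> L2.Seq M \<longrightarrow>
          (L2.perfect_subtree M S T \<longleftrightarrow> L2.perfect_subtree M (L2.plus M S) (L2.star M T)))
    \<and> (\<forall>K\<in>Sets M. K \<subseteq> L2.Seq M \<longrightarrow>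
          (L2.perfect_kernel M K T \<longleftrightarrow> L2.perfect_kernel M (L2.plus M K) (L2.star M T)))"
proof -
  have T: "T \<in> Sets M" "T \<subseteq> L2.Seq M"
    using assms(2) unfolding L2.tree_def by auto
  \<comment> \<open>The tree itself is the set that makes \<open>Sets M\<close> nonempty.\<close>
  interpret inhabited_RCA0 M
    using assms(1) T(1) by (intro inhabited_RCA0.intro inhabited_RCA0_axioms.intro) auto
  show ?thesis
    using tree_star [OF assms(2)] well_founded_star_iff [OF T(2)] at_most_one_path_star_iff [OF T(2)]
      perfect_subtree_plus_iff perfect_kernel_plus_iff by blast
qed

end
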